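(* Let $n\ge 1$, let $\mathcal S$ be the real vector space of all real symmetric $n\times n$ matrices, and let $\mathcal S_+\subset\mathcal S$ be the open subset of positive definite matrices, with Riemannian metric $$G_D(X,Y)=\int_0^\infty \operatorname{Tr}\big((D+t)^{-1}X(D+t)^{-1}Y\big)\,dt,\qquad D\in\mathcal S_+,\ X,Y\in T_D\mathcal S_+=\mathcal S .$$ Then the Riemannian curvature tensor $R$ of $(\mathcal S_+,G)$ is given, for all $D\in\mathcal S_+$ and $X,Y,Z\in\mathcal S$, by $$\begin{aligned} R_D(X,Y)Z&=\tfrac14\, d(G^{-1})(D)(X)\big(dG(D)(Y)(Z)\big)-\tfrac14\, d(G^{-1})(D)(Y)\big(dG(D)(X)(Z)\big)\\ &=-\tfrac14\, G_D^{-1}\Big(dG(D)(X)\big(G_D^{-1}\big(dG(D)(Y)(Z)\big)\big)\Big)+\tfrac14\, G_D^{-1}\Big(dG(D)(Y)\big(G_D^{-1}\big(dG(D)(X)(Z)\big)\big)\Big), \end{aligned}$$ where in these formulas $G_D$ denotes the linear operator $G_D:\mathcal S\to\mathcal S$, $G_D(X)=\int_0^\infty (D+t)^{-1}X(D+t)^{-1}\,dt$.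
   Context: Here $D+t$ means $D+tI$ with $I$ the identity matrix. The space $\mathcal S$ is identified with its dual via the inner product $\langle X,Y\rangle=\operatorname{Tr}(XY)$; under this identification the bilinear form $G_D$ corresponds to the invertible linear operator $G_D:\mathcal S\to\mathcal S$, $G_D(X)=\int_0^\infty (D+t)^{-1}X(D+t)^{-1}\,dt$, i.e. $G_D(X,Y)=\langle G_D(X),Y\rangle$, and $G_D^{-1}$ is its inverse operator. For $D\in\mathcal S_+$ and $X\in\mathcal S$, $dG(D)(X):\mathcal S\to\mathcal S$ denotes the directional derivative at $D$ in the direction $X$ of the operator-valued map $D\mapsto G_D$, and $d(G^{-1})(D)(X):\mathcal S\to\mathcal S$ denotes the directional derivative at $D$ in the direction $X$ of the operator-valued map $D\mapsto G_D^{-1}$. The curvature convention is $R(\xi,\eta)\zeta=(\nabla_\xi\nabla_\eta-\nabla_\eta\nabla_\xi-\nabla_{[\xi,\eta]})\zeta$, where $\nabla$ is the Levi-Civita connection of $G$. Since $\mathcal S_+$ is open in the vector space $\mathcal S$, vector fields are smooth maps $\mathcal S_+\to\mathcal S$, and $(\nabla_\xi\eta)|_D=d\eta(D)(\xi(D))-\Gamma_D(\xi(D),\eta(D))$, where the Christoffel form $\Gamma_D:\mathcal S\times\mathcal S\to\mathcal S$ is determined by $$G_D(\Gamma_D(X,Y),Z)=\tfrac12 dG(D)(Z)(X,Y)-\tfrac12 dG(D)(X)(Z,Y)-\tfrac12 dG(D)(Y)(X,Z),$$ with $dG(D)(Z)(X,Y)$ the derivative at $D$ in direction $Z$ of $D\mapsto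 G_D(X,Y)$. *)

theory Defs
  imports "HOL-Analysis.Analysis"
begin

section \<open>The Euclidean space of real symmetric matrices\<close>

typedef 'n sym = "{A :: real ^ 'n ^ 'n. transpose A = A}"
  morphisms mat_of sym_of
  by (rule exI[of _ 0]) (simp add: transpose_def vec_eq_iff)

setup_lifting type_definition_sym

lemma transpose_mat_of [simp]: "transpose (mat_of X) = mat_of X"
  using mat_of[of X] by simp

lemma mat_of_nth_commute: "mat_of X $ i $ j = mat_of X $ j $ i"
  using arg_cong[OF transpose_mat_of[of X], of "\<lambda>A. A $ j $ i"] by (simp add: transpose_def)

instantiation sym :: (finite) real_vector
begin

lift_definition zero_sym :: "'a sym" is 0
  by (simp add: transpose_def vec_eq_iff)

lift_definition plus_sym :: "'a sym \<Rightarrow> 'a sym \<Rightarrow> 'a sym" is "(+)"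
  by (simp add: transpose_def vec_eq_iff)

lift_definition minus_sym :: "'a sym \<Rightarrow> 'a sym \<Rightarrow> 'a sym" is "(-)"
  by (simp add: transpose_def vec_eq_iff)

lift_definition uminus_sym :: "'a sym \<Rightarrow> 'a sym" is uminus
  by (simp add: transpose_def vec_eq_iff)

lift_definition scaleR_sym :: "real \<Rightarrow> 'a sym \<Rightarrow> 'a sym" is scaleR
  by (simp add: transpose_def vec_eq_iff)

instance
  by standard (transfer; simp add: algebra_simps)+

end

lemma trace_mult_mat_of: "trace (mat_of X ** mat_of Y) = mat_of X \<bullet> mat_of Y"
proof -
  have "trace (mat_of X ** mat_of Y) = (\<Sum>i\<in>UNIV. \<Sum>k\<in>UNIV. mat_of X $ i $ k * mat_of Y $ k $ i)"
    by (simp add: trace_def matrix_matrix_mult_def)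
  also have "\<dots> = (\<Sum>i\<in>UNIV. \<Sum>k\<in>UNIV. mat_of X $ i $ k * mat_of Y $ i $ k)"
    by (simp only: mat_of_nth_commute[of Y])
  finally show ?thesis
    by (simp add: inner_vec_def)
qed

instantiation sym :: (finite) real_inner
begin

definition inner_sym :: "'a sym \<Rightarrow> 'a sym \<Rightarrow> real" where
  "inner_sym X Y = trace (mat_of X ** mat_of Y)"

definition norm_sym :: "'a sym \<Rightarrow> real" where
  "norm_sym X = sqrt (X \<bullet> X)"

definition sgn_sym :: "'a sym \<Rightarrow> 'a sym" where
  "sgn_sym X = X /\<^sub>R norm X"

definition dist_sym :: "'a sym \<Rightarrow> 'a sym \<Rightarrow> real" where
  "dist_sym X Y = norm (X - Y)"

definition uniformity_sym :: "('a sym \<times> 'a sym) filter" where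
  "uniformity_sym = (INF e\<in>{0<..}. principal {(X, Y). dist X Y < e})"

definition open_sym :: "'a sym set \<Rightarrow> bool" where
  "open_sym U \<longleftrightarrow> (\<forall>X\<in>U. eventually (\<lambda>(X', Y). X' = X \<longrightarrow> Y \<in> U) uniformity)"

instance
proof
  fix X Y Z :: "'a sym" and r :: real and U :: "'a sym set"
  show "dist X Y = norm (X - Y)" by (rule dist_sym_def)
  show "sgn X = X /\<^sub>R norm X" by (rule sgn_sym_def)
  show "uniformity = (INF e\<in>{0<..}. principal {(X, Y :: 'a sym). dist X Y < e})"
    by (rule uniformity_sym_def)
  show "open U \<longleftrightarrow> (\<forall>X\<in>U. eventually (\<lambda>(X', Y). X' = X \<longrightarrow> Y \<in> U) uniformity)"
    by (rule open_sym_def)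
  show "norm X = sqrt (X \<bullet> X)" by (rule norm_sym_def)
  show "X \<bullet> Y = Y \<bullet> X"
    by (simp add: inner_sym_def trace_mult_mat_of inner_commute)
  show "(X + Y) \<bullet> Z = X \<bullet> Z + Y \<bullet> Z"
    by (simp add: inner_sym_def trace_mult_mat_of) (simp add: plus_sym.rep_eq inner_add_left)
  show "(r *\<^sub>R X) \<bullet> Y = r * (X \<bullet> Y)"
    by (simp add: inner_sym_def trace_mult_mat_of) (simp add: scaleR_sym.rep_eq)
  show "0 \<le> X \<bullet> X"
    by (simp add: inner_sym_def trace_mult_mat_of)
  show "X \<bullet> X = 0 \<longleftrightarrow> X = 0"
    by (simp add: inner_sym_def trace_mult_mat_of zero_sym.rep_eq flip: mat_of_inject)
qed

end

lift_definition sym_unit :: "'n \<Rightarrow> 'n \<Rightarrow> 'n::finite sym" is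
  "\<lambda>i j. axis i (axis j 1) + axis j (axis i 1)"
  by (auto simp: transpose_def vec_eq_iff axis_def)

lemma inner_sym_unit: "X \<bullet> sym_unit i j = 2 * mat_of X $ i $ j"
  by (simp add: inner_sym_def trace_mult_mat_of)
    (simp add: sym_unit.rep_eq inner_add_right inner_axis mat_of_nth_commute[of X j i])

lemma sym_unit_nonzero: "sym_unit i j \<noteq> 0"
proof
  assume "sym_unit i j = 0"
  then have "mat_of (sym_unit i j) $ i $ j = 0" by (simp add: zero_sym.rep_eq)
  then show False by (auto simp: sym_unit.rep_eq axis_def split: if_splits)
qed

instantiation sym :: (finite) euclidean_space
begin

definition Basis_sym :: "'a sym set" where
  "Basis_sym = (\<Union>i. \<Union>j. {sgn (sym_unit i j)})"

instance
proof
  show "(Basis :: 'a sym set) \<noteq> {}" by (auto simp: Basis_sym_def)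
  show "finite (Basis :: 'a sym set)" by (simp add: Basis_sym_def)
next
  fix u v :: "'a sym"
  assume "u \<in> Basis" "v \<in> Basis"
  then obtain i j k l where u: "u = sgn (sym_unit i j)" and v: "v = sgn (sym_unit k l)"
    by (auto simp: Basis_sym_def)
  have self: "u \<bullet> u = 1"
    by (simp add: u sym_unit_nonzero norm_sgn flip: power2_norm_eq_inner)
  show "u \<bullet> v = (if u = v then 1 else 0)"
  proof (cases "u = v")
    case True
    with self show ?thesis by simp
  next
    case False
    have "sym_unit i j = sym_unit j i"
      by transfer (simp add: add.commute)
    with False u v have "\<not> (i = k \<and> j = l)" "\<not> (i = l \<and> j = k)" by auto
    then have "mat_of (sym_unit i j) $ k $ l = 0"
      by (auto simp: sym_unit.rep_eq axis_def)
    then have "sym_unit i j \<bullet> sym_unit k l = 0" by (simp add: inner_sym_unit)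
    with False u v show ?thesis by (simp add: sgn_div_norm)
  qed
next
  fix X :: "'a sym"
  show "(\<forall>u\<in>Basis. X \<bullet> u = 0) \<longleftrightarrow> X = 0"
  proof
    assume *: "\<forall>u\<in>Basis. X \<bullet> u = 0"
    have "mat_of X $ i $ j = 0" for i j
    proof -
      have "X \<bullet> sgn (sym_unit i j) = 0" using * by (auto simp: Basis_sym_def)
      then have "X \<bullet> sym_unit i j = 0" using sym_unit_nonzero[of i j] by (simp add: sgn_div_norm)
      then show ?thesis by (simp add: inner_sym_unit)
    qed
    then show "X = 0" by (simp add: vec_eq_iff zero_sym.rep_eq flip: mat_of_inject)
  qed simp
qed

end

section \<open>The metric and its operator\<close>

definition posdef :: "'n::finite sym set" where
  "posdef = {D. \<forall>x. x \<noteq> 0 \<longrightarrow> 0 < x \<bullet> (mat_of D *v x)}"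

definition resolvent :: "'n::finite sym \<Rightarrow> real \<Rightarrow> real ^ 'n ^ 'n" where
  "resolvent D t = matrix_inv (mat_of D + mat t)"

definition metric :: "'n::finite sym \<Rightarrow> 'n sym \<Rightarrow> 'n sym \<Rightarrow> real" where
  "metric D X Y =
    integral {0..} (\<lambda>t. trace (resolvent D t ** mat_of X ** resolvent D t ** mat_of Y))"

text \<open>For positive definite \<open>D\<close> and \<open>t \<ge> 0\<close> the matrix passed to \<^const>\<open>sym_of\<close> is symmetric,
  the map below is linear in \<open>X\<close>, and it is invertible.\<close>

definition metric_op :: "'n::finite sym \<Rightarrow> 'n sym \<Rightarrow>\<^sub>L 'n sym" where
  "metric_op D =
    Blinfun (\<lambda>X. integral {0..} (\<lambda>t. sym_of (resolvent D t ** mat_of X ** resolvent D t)))"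

definition metric_op_inv :: "'n::finite sym \<Rightarrow> 'n sym \<Rightarrow>\<^sub>L 'n sym" where
  "metric_op_inv D = Blinfun (inv (blinfun_apply (metric_op D)))"

section \<open>Derivatives and smooth maps\<close>

definition dir_deriv ::
    "('a::real_normed_vector \<Rightarrow> 'b::real_normed_vector) \<Rightarrow> 'a \<Rightarrow> 'a \<Rightarrow> 'b" where
  "dir_deriv f D X = vector_derivative (\<lambda>s. f (D + s *\<^sub>R X)) (at 0)"

primrec Ck_on ::
    "nat \<Rightarrow> 'a set \<Rightarrow> ('a::euclidean_space \<Rightarrow> 'b::real_normed_vector) \<Rightarrow> bool" where
  "Ck_on 0 U f \<longleftrightarrow> continuous_on U f"
| "Ck_on (Suc k) U f \<longleftrightarrow>
    (\<forall>D\<in>U. f differentiable (at D)) \<and> (\<forall>X. Ck_on k U (\<lambda>D. dir_deriv f D X))"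

definition smooth_on :: "'a set \<Rightarrow> ('a::euclidean_space \<Rightarrow> 'b::real_normed_vector) \<Rightarrow> bool" where
  "smooth_on U f \<longleftrightarrow> (\<forall>k. Ck_on k U f)"

section \<open>Levi-Civita connection and curvature\<close>

definition christoffel :: "'n::finite sym \<Rightarrow> 'n sym \<Rightarrow> 'n sym \<Rightarrow> 'n sym" where
  "christoffel D X Y = (THE W. \<forall>Z. metric D W Z =
      1/2 * dir_deriv (\<lambda>E. metric E X Y) D Z
    - 1/2 * dir_deriv (\<lambda>E. metric E Z Y) D X
    - 1/2 * dir_deriv (\<lambda>E. metric E X Z) D Y)"

text \<open>Vector fields on \<^const>\<open>posdef\<close> are total functions; only their values on the open set
  \<^const>\<open>posdef\<close> matter. The sign in front of the Christoffel form is the one matching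
  its definition above, opposite to the usual textbook convention.\<close>

definition covariant ::
    "('n::finite sym \<Rightarrow> 'n sym) \<Rightarrow> ('n sym \<Rightarrow> 'n sym) \<Rightarrow> 'n sym \<Rightarrow> 'n sym" where
  "covariant \<xi> \<eta> D = dir_deriv \<eta> D (\<xi> D) - christoffel D (\<xi> D) (\<eta> D)"

definition lie_bracket ::
    "('n::finite sym \<Rightarrow> 'n sym) \<Rightarrow> ('n sym \<Rightarrow> 'n sym) \<Rightarrow> 'n sym \<Rightarrow> 'n sym" where
  "lie_bracket \<xi> \<eta> D = dir_deriv \<eta> D (\<xi> D) - dir_deriv \<xi> D (\<eta> D)"

definition curvature ::
    "('n::finite sym \<Rightarrow> 'n sym) \<Rightarrow> ('n sym \<Rightarrow> 'n sym) \<Rightarrow> ('n sym \<Rightarrow> 'n sym) \<Rightarrow> 'n sym \<Rightarrow> 'n sym" where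
  "curvature \<xi> \<eta> \<zeta> D =
    covariant \<xi> (covariant \<eta> \<zeta>) D - covariant \<eta> (covariant \<xi> \<zeta>) D
    - covariant (lie_bracket \<xi> \<eta>) \<zeta> D"

end

theory Submission
  imports Defs
begin

text \<open>The cubic form \<open>dG(D)(X)(Y, Z)\<close> is totally symmetric: \<open>G\<^sub>D\<close> is self-adjoint, and
  differentiating under the integral exhibits \<open>dG(D)(X)(Y)\<close> as symmetric in \<open>X\<close> and \<open>Y\<close>. Hence the
  Christoffel form is \<open>-1/2 A(X)Y\<close> with \<open>A(X) = G\<inverse> dG(X)\<close>, and the connection is
  \<open>\<nabla>\<^sub>X = \<partial>\<^sub>X + 1/2 A(X)\<close>. Its curvature is \<open>1/2 (dA(X)(Y) - dA(Y)(X)) + 1/4 [A(X), A(Y)]\<close>. Since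
  second derivatives of \<open>G\<close> are symmetric and \<open>d(G\<inverse>)(X) = - G\<inverse> dG(X) G\<inverse>\<close>, the first bracket equals
  \<open>- [A(X), A(Y)]\<close>, which leaves \<open>- 1/4 [A(X), A(Y)]\<close>.\<close>

section \<open>Derivatives of operator-valued maps\<close>

text \<open>The identity \<open>dG(X)(Y) = dG(Y)(X)\<close> is no accident: \<open>G\<close> at
  \<open>D\<close> is the derivative of the matrix logarithm, so \<open>dG\<close> is a second
  derivative. The analytic obstacle is that \<open>G\<close> is an improper integral of inverses and
  has to be differentiated twice. On the half-line this would call for dominating functions locally
  uniform in \<open>D\<close>; on a compact parameter interval joint continuity is enough. The
  definitions speak of directional derivatives, whereas the product rule and the symmetry of second
  derivatives are applied to operator-valued Frechet derivatives. In finite dimension these can be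
  assembled from their values at fixed vectors. Curvature is evaluated on arbitrary smooth fields,
  so the derivatives of the fields must cancel as well: first derivatives against the bracket or in
  symmetric pairs, the second derivative of the third field by symmetry. Finally
  \<open>d(G\<inverse>)(X)(dG(Y)(Z)) = - A(X)(A(Y)(Z))\<close>, so both claimed formulas are
  \<open>- 1/4 [A(X), A(Y)] Z\<close>.\<close>

lemma dir_deriv_eq:
  assumes "(f has_derivative f') (at D)"
  shows "dir_deriv f D X = f' X"
proof -
  have "((\<lambda>s. D + s *\<^sub>R X) has_derivative (\<lambda>s. s *\<^sub>R X)) (at 0)"
    by (auto intro!: derivative_eq_intros)
  then have "((\<lambda>s. f (D + s *\<^sub>R X)) has_derivative (\<lambda>s. f' (s *\<^sub>R X))) (at 0)"
    by (rule has_derivative_compose) (use assms in simp)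
  moreover have "f' (s *\<^sub>R X) = s *\<^sub>R f' X" for s
    using assms by (simp add: has_derivative_bounded_linear bounded_linear.linear linear_cmul)
  ultimately show ?thesis
    unfolding dir_deriv_def by (intro vector_derivative_at) (simp add: has_vector_derivative_def)
qed

lemma has_derivative_blinfun_right:
  assumes "(F has_derivative F') (at x within S)"
  shows "((\<lambda>x. blinfun_apply (F x) v) has_derivative (\<lambda>h. blinfun_apply (F' h) v)) (at x within S)"
  using bounded_linear.has_derivative[OF blinfun.bounded_linear_left assms] .

text \<open>An operator is the sum of rank-one operators built from its values on a basis, and each
  of these depends linearly on the value.\<close>

lemma differentiable_blinfun_componentwise:
  fixes F :: "'a::real_normed_vector \<Rightarrow> 'b::euclidean_space \<Rightarrow>\<^sub>L 'c::real_normed_vector"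
  assumes "\<And>b. b \<in> Basis \<Longrightarrow> (\<lambda>x. blinfun_apply (F x) b) differentiable (at x within S)"
  shows "F differentiable (at x within S)"
proof -
  \<comment> \<open>\<open>T b v\<close> is the rank-one operator sending \<open>w\<close> to
    \<open>(w \<bullet> b) *\<^sub>R v\<close>.\<close>
  define T :: "'b \<Rightarrow> 'c \<Rightarrow> 'b \<Rightarrow>\<^sub>L 'c" where "T b v = blinfun_scaleR_left v o\<^sub>L blinfun_inner_left b" for b v
  have T: "bounded_linear (T b)" for b
    unfolding T_def
    by (rule bounded_linear_compose[OF bounded_bilinear.bounded_linear_left[OF bounded_bilinear_blinfun_compose]
        bounded_linear_blinfun_scaleR_left])
  have "F = (\<lambda>x. \<Sum>b\<in>Basis. T b (blinfun_apply (F x) b))"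
  proof (rule ext, rule blinfun_eqI)
    fix x v
    have "blinfun_apply (F x) v = blinfun_apply (F x) (\<Sum>b\<in>Basis. (v \<bullet> b) *\<^sub>R b)"
      by (simp add: euclidean_representation)
    then show "blinfun_apply (F x) v = blinfun_apply (\<Sum>b\<in>Basis. T b (blinfun_apply (F x) b)) v"
      by (simp add: T_def blinfun.bilinear_simps)
  qed
  moreover have "(\<lambda>x. \<Sum>b\<in>Basis. T b (blinfun_apply (F x) b)) differentiable (at x within S)"
  proof (intro differentiable_sum ballI)
    fix b :: 'b assume "b \<in> Basis"
    then obtain F' where "((\<lambda>x. blinfun_apply (F x) b) has_derivative F') (at x within S)"
      using assms by (auto simp: differentiable_def)
    from bounded_linear.has_derivative[OF T this]
    show "(\<lambda>x. T b (blinfun_apply (F x) b)) differentiable (at x within S)"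
      unfolding differentiable_def by blast
  qed simp
  ultimately show ?thesis by simp
qed

text \<open>Leibniz rule with joint continuity demanded only for each fixed direction
  \<open>h\<close>; in finite dimension this already gives continuity of the derivative in operator
  norm.\<close>

lemma has_derivative_integral_componentwise:
  fixes f :: "'a::euclidean_space \<Rightarrow> real \<Rightarrow> 'b::banach"
  assumes U: "open U" "convex U" "x \<in> U"
    and der: "\<And>x t. x \<in> U \<Longrightarrow> t \<in> {a..b} \<Longrightarrow> ((\<lambda>x. f x t) has_derivative f' x t) (at x)"
    and cont: "\<And>x. x \<in> U \<Longrightarrow> continuous_on {a..b} (f x)"
    and cont': "\<And>h. continuous_on (U \<times> {a..b}) (\<lambda>p. f' (fst p) (snd p) h)"
  shows "((\<lambda>x. integral {a..b} (f x)) has_derivative (\<lambda>h. integral {a..b} (\<lambda>t. f' x t h))) (at x)"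
proof -
  have app: "blinfun_apply (Blinfun (f' x t)) = f' x t" if "x \<in> U" "t \<in> {a..b}" for x t
    using der[OF that] by (simp add: has_derivative_bounded_linear bounded_linear_Blinfun_apply)
  have c: "continuous_on (U \<times> {a..b}) (\<lambda>p. Blinfun (f' (fst p) (snd p)))"
  proof (rule continuous_on_blinfun_componentwise)
    fix i :: 'a
    show "continuous_on (U \<times> {a..b}) (\<lambda>p. blinfun_apply (Blinfun (f' (fst p) (snd p))) i)"
      using cont'[of i] by (rule continuous_on_eq) (auto simp: app)
  qed
  have cx: "continuous_on {a..b} (\<lambda>t. Blinfun (f' x t))"
    using continuous_on_compose2[OF c, of "{a..b}" "Pair x"] U
    by (simp add: image_subset_iff continuous_on_Pair)
  have "((\<lambda>x. integral (cbox a b) (f x)) has_derivative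
      blinfun_apply (integral (cbox a b) (\<lambda>t. Blinfun (f' x t)))) (at x within U)"
  proof (rule leibniz_rule)
    fix y t assume "y \<in> U" "t \<in> cbox a b"
    with der[of y t] show "((\<lambda>y. f y t) has_derivative blinfun_apply (Blinfun (f' y t))) (at y within U)"
      by (simp add: app has_derivative_at_withinI)
  next
    fix y assume "y \<in> U"
    with cont[of y] show "f y integrable_on cbox a b"
      by (simp add: integrable_continuous_real)
  qed (use U c in \<open>auto simp: case_prod_beta'\<close>)
  moreover have "blinfun_apply (integral (cbox a b) (\<lambda>t. Blinfun (f' x t))) = (\<lambda>h. integral {a..b} (\<lambda>t. f' x t h))"
  proof
    fix h
    have "blinfun_apply (integral {a..b} (\<lambda>t. Blinfun (f' x t))) h
        = integral {a..b} (\<lambda>t. blinfun_apply (Blinfun (f' x t)) h)"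
      by (rule blinfun_apply_integral) (rule integrable_continuous_real[OF cx])
    also have "\<dots> = integral {a..b} (\<lambda>t. f' x t h)"
      by (rule integral_cong) (simp add: app U)
    finally show "blinfun_apply (integral (cbox a b) (\<lambda>t. Blinfun (f' x t))) h = integral {a..b} (\<lambda>t. f' x t h)"
      by simp
  qed
  ultimately have "((\<lambda>x. integral {a..b} (f x)) has_derivative (\<lambda>h. integral {a..b} (\<lambda>t. f' x t h))) (at x within U)"
    unfolding box_real by (simp only:)
  then show ?thesis
    by (simp only: at_within_open[OF U(3) U(1)])
qed

text \<open>Product rule for a factor \<open>f\<close> that is merely continuous: since
  \<open>g x = 0\<close>, the error \<open>prod (f y - f x) (g y)\<close> is o(1) times O(|y - x|).
  It serves to differentiate an inverse whose differentiability is not yet known.\<close>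

lemma (in bounded_bilinear) has_derivative_times_zero:
  assumes a: "continuous (at x within S) f"
    and g: "(g has_derivative g') (at x within S)" and 0: "g x = 0"
  shows "((\<lambda>y. prod (f y) (g y)) has_derivative (\<lambda>h. prod (f x) (g' h))) (at x within S)"
proof -
  obtain K where K: "K > 0" "\<And>a b. norm (prod a b) \<le> norm a * norm b * K"
    using pos_bounded by auto
  have blg: "bounded_linear g'" using g by (rule has_derivative_bounded_linear)
  obtain B where B: "B > 0" "\<And>h. norm (g' h) \<le> norm h * B"
    using bounded_linear.pos_bounded[OF blg] by blast
  have "((\<lambda>y. prod (f y - f x) (g y)) has_derivative (\<lambda>h. 0)) (at x within S)"
    unfolding has_derivative_within_alt2
  proof (intro conjI allI impI)
    fix e :: real assume e: "e > 0"
    \<comment> \<open>Near \<open>x\<close>, \<open>norm (g y)\<close> is at most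
      \<open>(B + 1) * norm (y - x)\<close>: \<open>B\<close> comes from \<open>g'\<close>, and 1
      from the remainder estimate with tolerance 1.\<close>
    define d where "d = e / (K * (B + 1))"
    have d: "d > 0" "d * (K * (B + 1)) = e" using e K B by (auto simp: d_def)
    have "eventually (\<lambda>y. norm (g y - g x - g' (y - x)) \<le> 1 * norm (y - x)) (at x within S)"
      using g unfolding has_derivative_within_alt2 by (meson zero_less_one)
    moreover have "eventually (\<lambda>y. dist (f y) (f x) < d) (at x within S)"
      using a d(1) unfolding continuous_within by (rule tendstoD)
    ultimately show "eventually (\<lambda>y. norm (prod (f y - f x) (g y) - prod (f x - f x) (g x) - 0) \<le> e * norm (y - x)) (at x within S)"
    proof eventually_elim
      case (elim y)
      have "norm (g y) \<le> norm (g y - g' (y - x)) + norm (g' (y - x))"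
        using norm_triangle_ineq[of "g y - g' (y - x)" "g' (y - x)"] by simp
      also have "\<dots> \<le> norm (y - x) * (B + 1)"
        using elim(1) B(2)[of "y - x"] 0 by (simp add: algebra_simps)
      finally have gy: "norm (g y) \<le> norm (y - x) * (B + 1)" .
      have "norm (prod (f y - f x) (g y)) \<le> norm (f y - f x) * norm (g y) * K"
        by (rule K)
      also have "\<dots> \<le> d * (norm (y - x) * (B + 1)) * K"
        using elim(2) gy d K B by (intro mult_right_mono mult_mono) (auto simp: dist_norm)
      also have "\<dots> = (d * (K * (B + 1))) * norm (y - x)" by (simp add: algebra_simps)
      finally show ?case using 0 d by (simp add: zero_right)
    qed
  qed simp
  moreover have "((\<lambda>y. prod (f x) (g y)) has_derivative (\<lambda>h. prod (f x) (g' h))) (at x within S)"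
    using bounded_linear.has_derivative[OF bounded_linear_right g] .
  ultimately have "((\<lambda>y. prod (f y - f x) (g y) + prod (f x) (g y)) has_derivative (\<lambda>h. 0 + prod (f x) (g' h))) (at x within S)"
    by (rule has_derivative_add)
  then show ?thesis by (simp add: add_left[symmetric])
qed

text \<open>Of \<open>J = F\<inverse>\<close> only the resolvent identity is used, so that the next two lemmas serve both
  matrices and operators.\<close>

lemma (in bounded_bilinear) continuous_on_resolvent:
  fixes F :: "'d::topological_space \<Rightarrow> 'b" and J :: "'d \<Rightarrow> 'a"
  assumes q: "bounded_bilinear q"
    and res: "\<And>x y. x \<in> S \<Longrightarrow> y \<in> S \<Longrightarrow> J x - J y = q (prod (J x) (F y - F x)) (J y)"
    and F: "continuous_on S F"
  shows "continuous_on S J"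
  unfolding continuous_on_def
proof
  fix y assume y: "y \<in> S"
  obtain K where K: "K > 0" "\<And>a b. norm (prod a b) \<le> norm a * norm b * K"
    using pos_bounded by auto
  obtain L where L: "L > 0" "\<And>a b. norm (q a b) \<le> norm a * norm b * L"
    using bounded_bilinear.pos_bounded[OF q] by auto
  \<comment> \<open>The summand 1 keeps \<open>c\<close> positive when
    \<open>J y = 0\<close>.\<close>
  define c where "c = K * L * norm (J y) + 1"
  have c: "c > 0" "K * L * norm (J y) \<le> c" using K L by (simp_all add: c_def add_nonneg_pos)
  have tF: "(F \<longlongrightarrow> F y) (at y within S)"
    using F y by (auto simp: continuous_on_def)
  have ineq: "norm (J x - J y) \<le> norm (J x) * (norm (F x - F y) * c)" if "x \<in> S" for x
  proof -
    have "norm (J x - J y) \<le> norm (prod (J x) (F y - F x)) * norm (J y) * L"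
      unfolding res[OF that y] by (rule L)
    also have "\<dots> \<le> (norm (J x) * norm (F y - F x) * K) * norm (J y) * L"
      using K L by (intro mult_right_mono) auto
    also have "\<dots> = (norm (J x) * norm (F x - F y)) * (K * L * norm (J y))"
      by (simp add: norm_minus_commute)
    also have "\<dots> \<le> (norm (J x) * norm (F x - F y)) * c"
      using c by (intro mult_left_mono) auto
    finally show ?thesis by (simp add: mult.assoc)
  qed
  \<comment> \<open>Within this radius \<open>ineq\<close> gives
    \<open>norm (J x - J y) \<le> norm (J x) / 2\<close>, hence
    \<open>norm (J x) \<le> 2 * norm (J y)\<close>. This local bound is fed back into
    \<open>ineq\<close>.\<close>
  have "eventually (\<lambda>x. dist (F x) (F y) < 1 / (2 * c)) (at y within S)"
    using c by (intro tendstoD[OF tF]) auto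
  moreover have "eventually (\<lambda>x. x \<in> S) (at y within S)"
    by (simp add: eventually_at_filter)
  ultimately have "eventually (\<lambda>x. norm (J x - J y) \<le> (2 * norm (J y) * c) * norm (F x - F y)) (at y within S)"
  proof eventually_elim
    case (elim x)
    have "norm (F x - F y) * c \<le> 1 / 2"
      using elim(1) c by (simp add: dist_norm field_simps)
    then have "norm (J x) * (norm (F x - F y) * c) \<le> norm (J x) * (1 / 2)"
      by (intro mult_left_mono) auto
    then have "norm (J x - J y) \<le> norm (J x) / 2" using ineq[OF elim(2)] by simp
    then have "norm (J x) \<le> 2 * norm (J y)"
      using norm_triangle_ineq[of "J x - J y" "J y"] by simp
    then have "norm (J x) * (norm (F x - F y) * c) \<le> 2 * norm (J y) * (norm (F x - F y) * c)"
      using c by (intro mult_right_mono) auto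
    with ineq[OF elim(2)] show ?case by (simp add: mult_ac)
  qed
  moreover have "((\<lambda>x. (2 * norm (J y) * c) * norm (F x - F y)) \<longlongrightarrow> (2 * norm (J y) * c) * norm (F y - F y)) (at y within S)"
    by (intro tendsto_mult tendsto_const tendsto_norm tendsto_diff tF)
  then have "((\<lambda>x. (2 * norm (J y) * c) * norm (F x - F y)) \<longlongrightarrow> 0) (at y within S)"
    by simp
  ultimately have "((\<lambda>x. J x - J y) \<longlongrightarrow> 0) (at y within S)"
    by (rule Lim_null_comparison)
  then show "(J \<longlongrightarrow> J y) (at y within S)" by (simp add: LIM_zero_iff)
qed

lemma (in bounded_bilinear) has_derivative_resolvent:
  fixes F :: "'d::real_normed_vector \<Rightarrow> 'b" and J :: "'d \<Rightarrow> 'a"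
  assumes q: "bounded_bilinear q"
    and res: "\<And>x y. x \<in> S \<Longrightarrow> y \<in> S \<Longrightarrow> J x - J y = q (prod (J x) (F y - F x)) (J y)"
    and F: "continuous_on S F" "(F has_derivative F') (at x)"
    and S: "open S" "x \<in> S"
  shows "(J has_derivative (\<lambda>h. - q (prod (J x) (F' h)) (J x))) (at x)"
proof -
  interpret q: bounded_bilinear q by fact
  have "continuous_on S J" by (rule continuous_on_resolvent[OF q res F(1)])
  then have J: "continuous (at x) J" using S continuous_on_eq_continuous_at by blast
  \<comment> \<open>By the resolvent identity
    \<open>J y = J x + q (prod (J y) (F x - F y)) (J x)\<close>. The factor \<open>F x - F y\<close>
    vanishes at \<open>y = x\<close>, so continuity of \<open>J\<close> is all that the product rule
    asks of it.\<close>
  have "((\<lambda>y. F x - F y) has_derivative (\<lambda>h. - F' h)) (at x)"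
    using F(2) by (auto intro!: derivative_eq_intros)
  from has_derivative_times_zero[OF J this]
  have "((\<lambda>y. prod (J y) (F x - F y)) has_derivative (\<lambda>h. prod (J x) (- F' h))) (at x)" by simp
  from bounded_linear.has_derivative[OF q.bounded_linear_left this, of "J x"]
  have "((\<lambda>y. J x + q (prod (J y) (F x - F y)) (J x)) has_derivative (\<lambda>h. 0 + q (prod (J x) (- F' h)) (J x))) (at x)"
    by (intro has_derivative_add) auto
  then have "((\<lambda>y. J x + q (prod (J y) (F x - F y)) (J x)) has_derivative (\<lambda>h. - q (prod (J x) (F' h)) (J x))) (at x)"
    by (simp add: minus_right q.minus_left)
  then show ?thesis
  proof (rule has_derivative_transform_within_open[OF _ S])
    fix y assume "y \<in> S"
    then have "q (prod (J y) (F x - F y)) (J x) = J y - J x"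
      using res S(2) by metis
    then show "J x + q (prod (J y) (F x - F y)) (J x) = J y" by simp
  qed
qed

section \<open>Symmetry of second derivatives\<close>

text \<open>The mean value theorem along \<open>h\<close> turns the second difference into
  \<open>t\<close> times a difference of \<open>f1\<close> at two points \<open>P\<close> and
  \<open>Q\<close> with \<open>P - Q = t *\<^sub>R k\<close>. Linearising \<open>f1\<close> in
  direction \<open>h\<close> at \<open>D\<close> leaves \<open>t\<^sup>2 * A k\<close> and two
  remainders.\<close>

lemma second_difference_bound:
  fixes f :: "'a::real_normed_vector \<Rightarrow> real"
  assumes U: "open U" "D \<in> U"
    and f: "\<And>E. E \<in> U \<Longrightarrow> (f has_derivative f1 E) (at E)"
    and A: "((\<lambda>E. f1 E h) has_derivative A) (at D)"
    and e: "e > 0"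
  shows "eventually (\<lambda>t. \<bar>f (D + t *\<^sub>R h + t *\<^sub>R k) - f (D + t *\<^sub>R h) - f (D + t *\<^sub>R k) + f D - t\<^sup>2 * A k\<bar> \<le> e * t\<^sup>2)
    (at_right 0)"
proof -
  define n where "n = norm h + norm k"
  have n: "n \<ge> 0" by (simp add: n_def)
  \<comment> \<open>Both intermediate points lie within \<open>t * n\<close> of \<open>D\<close>, so
    the two remainders contribute at most \<open>2 * (e' * n) * t\<^sup>2\<close>. The 1 covers
    \<open>n = 0\<close>.\<close>
  define e' where "e' = e / (2 * n + 1)"
  have e': "e' > 0" "2 * (e' * n) \<le> e" using e n by (auto simp: e'_def field_simps)
  obtain r where r: "r > 0" "ball D r \<subseteq> U" using U openE by blast
  obtain d where d: "d > 0"
    "\<And>y. norm (y - D) < d \<Longrightarrow> norm (f1 y h - f1 D h - A (y - D)) \<le> e' * norm (y - D)"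
    using A e'(1) unfolding has_derivative_at_alt by meson
  have A_lin: "linear A" using A has_derivative_bounded_linear bounded_linear.linear by blast
  define m where "m = min d r / (n + 1)"
  have m: "m > 0" using d r n by (simp add: m_def)
  have "\<bar>f (D + t *\<^sub>R h + t *\<^sub>R k) - f (D + t *\<^sub>R h) - f (D + t *\<^sub>R k) + f D - t\<^sup>2 * A k\<bar> \<le> e * t\<^sup>2"
    if t: "0 < t" "t < m" for t
  proof -
    have tn: "t * n < min d r"
    proof -
      have "t * n \<le> t * (n + 1)" using t by simp
      also have "\<dots> < m * (n + 1)" using t n by (intro mult_strict_right_mono) auto
      also have "\<dots> = min d r" using n by (simp add: m_def)
      finally show ?thesis .
    qed
    have near: "norm (s *\<^sub>R t *\<^sub>R h + c *\<^sub>R t *\<^sub>R k) \<le> t * n" if "s \<in> {0..1}" "c \<in> {0..1}" for s c :: real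
    proof -
      have "norm (s *\<^sub>R t *\<^sub>R h + c *\<^sub>R t *\<^sub>R k) \<le> s * (t * norm h) + c * (t * norm k)"
        using norm_triangle_ineq[of "s *\<^sub>R t *\<^sub>R h" "c *\<^sub>R t *\<^sub>R k"] t that by simp
      also have "\<dots> \<le> 1 * (t * norm h) + 1 * (t * norm k)"
        using that t by (intro add_mono mult_right_mono) auto
      finally show ?thesis by (simp add: n_def algebra_simps)
    qed
    have inU: "D + (s *\<^sub>R t *\<^sub>R h + c *\<^sub>R t *\<^sub>R k) \<in> U" if "s \<in> {0..1}" "c \<in> {0..1}" for s c :: real
    proof -
      have "D + (s *\<^sub>R t *\<^sub>R h + c *\<^sub>R t *\<^sub>R k) \<in> ball D r"
        using near[OF that] tn unfolding mem_ball dist_commute[of D] by (simp only: dist_norm add_diff_cancel_left')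
      with r show ?thesis by blast
    qed
    \<comment> \<open>The coefficients 1 and 0 are written out so that \<open>inU\<close>,
      \<open>near\<close> and \<open>fc\<close> apply to both sides of the parallelogram by
      specialising \<open>c\<close>.\<close>
    define \<phi> where "\<phi> s = f (D + (s *\<^sub>R t *\<^sub>R h + 1 *\<^sub>R t *\<^sub>R k)) - f (D + (s *\<^sub>R t *\<^sub>R h + 0 *\<^sub>R t *\<^sub>R k))" for s
    have f1_lin: "linear (f1 E)" if "E \<in> U" for E
      using f[OF that] has_derivative_bounded_linear bounded_linear.linear by blast
    have fc: "((\<lambda>s. f (D + (s *\<^sub>R t *\<^sub>R h + c *\<^sub>R t *\<^sub>R k))) has_derivative
        (\<lambda>x. f1 (D + (s *\<^sub>R t *\<^sub>R h + c *\<^sub>R t *\<^sub>R k)) (x *\<^sub>R t *\<^sub>R h))) (at s within {0..1})"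
      if "s \<in> {0..1}" "c \<in> {0..1}" for s c :: real
    proof (rule has_derivative_compose[where g = f])
      show "((\<lambda>s. D + (s *\<^sub>R t *\<^sub>R h + c *\<^sub>R t *\<^sub>R k)) has_derivative (\<lambda>x. x *\<^sub>R t *\<^sub>R h)) (at s within {0..1})"
        by (auto intro!: derivative_eq_intros)
    qed (rule f[OF inU[OF that]])
    have "\<exists>s\<in>{0<..<1}. \<phi> 1 - \<phi> 0 = f1 (D + (s *\<^sub>R t *\<^sub>R h + 1 *\<^sub>R t *\<^sub>R k)) ((1 - 0) *\<^sub>R t *\<^sub>R h)
        - f1 (D + (s *\<^sub>R t *\<^sub>R h + 0 *\<^sub>R t *\<^sub>R k)) ((1 - 0) *\<^sub>R t *\<^sub>R h)"
      unfolding \<phi>_def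
    proof (rule mvt_simple[where f' = "\<lambda>s x. f1 (D + (s *\<^sub>R t *\<^sub>R h + 1 *\<^sub>R t *\<^sub>R k)) (x *\<^sub>R t *\<^sub>R h)
          - f1 (D + (s *\<^sub>R t *\<^sub>R h + 0 *\<^sub>R t *\<^sub>R k)) (x *\<^sub>R t *\<^sub>R h)"])
      fix s :: real assume "0 \<le> s" "s \<le> 1"
      then show "((\<lambda>s. f (D + (s *\<^sub>R t *\<^sub>R h + 1 *\<^sub>R t *\<^sub>R k)) - f (D + (s *\<^sub>R t *\<^sub>R h + 0 *\<^sub>R t *\<^sub>R k))) has_derivative
          (\<lambda>x. f1 (D + (s *\<^sub>R t *\<^sub>R h + 1 *\<^sub>R t *\<^sub>R k)) (x *\<^sub>R t *\<^sub>R h)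
            - f1 (D + (s *\<^sub>R t *\<^sub>R h + 0 *\<^sub>R t *\<^sub>R k)) (x *\<^sub>R t *\<^sub>R h))) (at s within {0..1})"
        using fc[of s 1] fc[of s 0] by (intro has_derivative_diff) (simp_all only: atLeastAtMost_iff zero_le_one order_refl conj_commute simp_thms)
    qed simp
    then obtain s where s: "s \<in> {0<..<1}"
      "\<phi> 1 - \<phi> 0 = f1 (D + (s *\<^sub>R t *\<^sub>R h + 1 *\<^sub>R t *\<^sub>R k)) (t *\<^sub>R h) - f1 (D + (s *\<^sub>R t *\<^sub>R h + 0 *\<^sub>R t *\<^sub>R k)) (t *\<^sub>R h)"
      by auto
    define P where "P = D + (s *\<^sub>R t *\<^sub>R h + 1 *\<^sub>R t *\<^sub>R k)"
    define Q where "Q = D + (s *\<^sub>R t *\<^sub>R h + 0 *\<^sub>R t *\<^sub>R k)"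
    have PU: "P \<in> U" and QU: "Q \<in> U" unfolding P_def Q_def using s(1) by (intro inU; simp)+
    have nP: "norm (P - D) \<le> t * n" and nQ: "norm (Q - D) \<le> t * n"
      unfolding P_def Q_def add_diff_cancel_left' using s(1) by (intro near; simp)+
    have "A (P - D) - A (Q - D) = t * A k"
      by (simp add: P_def Q_def linear_add[OF A_lin] linear_cmul[OF A_lin])
    moreover have "\<phi> 1 - \<phi> 0 = t * (f1 P h - f1 Q h)"
      unfolding s(2)[folded P_def Q_def]
      by (simp add: linear_cmul[OF f1_lin[OF PU]] linear_cmul[OF f1_lin[OF QU]] right_diff_distrib)
    ultimately have "\<phi> 1 - \<phi> 0 - t\<^sup>2 * A k = t * ((f1 P h - f1 D h - A (P - D)) - (f1 Q h - f1 D h - A (Q - D)))"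
      by (simp add: power2_eq_square algebra_simps)
    also have "\<bar>\<dots>\<bar> \<le> t * (e' * (t * n) + e' * (t * n))"
    proof -
      have "norm (f1 P h - f1 D h - A (P - D)) \<le> e' * (t * n)"
        using d(2)[of P] nP tn e' by (smt (verit) mult_left_mono)
      moreover have "norm (f1 Q h - f1 D h - A (Q - D)) \<le> e' * (t * n)"
        using d(2)[of Q] nQ tn e' by (smt (verit) mult_left_mono)
      ultimately have "\<bar>(f1 P h - f1 D h - A (P - D)) - (f1 Q h - f1 D h - A (Q - D))\<bar> \<le> e' * (t * n) + e' * (t * n)"
        unfolding real_norm_def by linarith
      then show ?thesis
        using t(1) by (simp only: abs_mult abs_of_pos mult_left_mono less_imp_le)
    qed
    also have "\<dots> = 2 * (e' * n) * t\<^sup>2" by (simp add: power2_eq_square)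
    also have "\<dots> \<le> e * t\<^sup>2" using e' by (intro mult_right_mono) auto
    finally show ?thesis by (simp add: \<phi>_def algebra_simps)
  qed
  then show ?thesis unfolding eventually_at_right_field using m by blast
qed

text \<open>Swapping \<open>h\<close> and \<open>k\<close> leaves the second difference unchanged,
  while it is \<open>t\<^sup>2 * A k\<close> in one reading and \<open>t\<^sup>2 * B h\<close> in
  the other, up to o(t^2).\<close>

lemma second_derivative_symmetric_real:
  fixes f :: "'a::real_normed_vector \<Rightarrow> real"
  assumes U: "open U" "D \<in> U"
    and f: "\<And>E. E \<in> U \<Longrightarrow> (f has_derivative f1 E) (at E)"
    and A: "((\<lambda>E. f1 E h) has_derivative A) (at D)"
    and B: "((\<lambda>E. f1 E k) has_derivative B) (at D)"
  shows "A k = B h"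
proof -
  have "\<bar>A k - B h\<bar> \<le> e" if e: "e > 0" for e
  proof -
    have "eventually (\<lambda>t. t > 0) (at_right (0::real))"
      by (simp add: eventually_at_right_less)
    moreover have "eventually (\<lambda>t. \<bar>f (D + t *\<^sub>R h + t *\<^sub>R k) - f (D + t *\<^sub>R h) - f (D + t *\<^sub>R k) + f D - t\<^sup>2 * A k\<bar> \<le> e / 2 * t\<^sup>2) (at_right 0)"
      by (rule second_difference_bound[OF U f A]) (use e in auto)
    moreover have "eventually (\<lambda>t. \<bar>f (D + t *\<^sub>R k + t *\<^sub>R h) - f (D + t *\<^sub>R k) - f (D + t *\<^sub>R h) + f D - t\<^sup>2 * B h\<bar> \<le> e / 2 * t\<^sup>2) (at_right 0)"
      by (rule second_difference_bound[OF U f B]) (use e in auto)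
    ultimately have "eventually (\<lambda>t. \<bar>A k - B h\<bar> \<le> e) (at_right (0::real))"
    proof eventually_elim
      case (elim t)
      have "t\<^sup>2 * \<bar>A k - B h\<bar> = \<bar>t\<^sup>2 * A k - t\<^sup>2 * B h\<bar>"
        by (simp add: abs_mult flip: right_diff_distrib)
      also have "\<dots> \<le> e * t\<^sup>2"
        using elim(2) elim(3) add.commute[of "t *\<^sub>R h" "t *\<^sub>R k"] by (simp only: add.assoc)
      finally show ?case using elim(1) by (simp add: mult.commute)
    qed
    then show ?thesis by simp
  qed
  then have "\<bar>A k - B h\<bar> \<le> 0" by (rule field_le_epsilon) simp
  then show ?thesis by simp
qed

lemma second_derivative_symmetric:
  fixes f :: "'a::real_normed_vector \<Rightarrow> 'b::euclidean_space" and f1 :: "'a \<Rightarrow> 'a \<Rightarrow>\<^sub>L 'b"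
  assumes U: "open U" "D \<in> U"
    and f: "\<And>E. E \<in> U \<Longrightarrow> (f has_derivative f1 E) (at E)"
    and f2: "(f1 has_derivative f2) (at D)"
  shows "blinfun_apply (f2 h) k = blinfun_apply (f2 k) h"
proof (rule euclidean_eqI)
  fix b :: 'b
  have f': "((\<lambda>E. f E \<bullet> b) has_derivative (\<lambda>h. blinfun_apply (f1 E) h \<bullet> b)) (at E)" if "E \<in> U" for E
    using f[OF that] by (rule has_derivative_inner_left)
  have "((\<lambda>E. blinfun_apply (f1 E) v \<bullet> b) has_derivative (\<lambda>h. blinfun_apply (f2 h) v \<bullet> b)) (at D)" for v
    by (intro has_derivative_inner_left has_derivative_blinfun_right f2)
  from second_derivative_symmetric_real[OF U f' this[of k] this[of h]]
  show "blinfun_apply (f2 h) k \<bullet> b = blinfun_apply (f2 k) h \<bullet> b" by simp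
qed

text \<open>\<open>Ck_on\<close> controls the derivative one direction at a time; this bundles the
  directions into an operator-valued map. Order two is what the third field needs in the
  curvature.\<close>

lemma Ck_on_imp_differentiable_derivative:
  fixes f :: "'a::euclidean_space \<Rightarrow> 'b::real_normed_vector"
  assumes f: "Ck_on 2 U f" and U: "open U"
  obtains f1 :: "'a \<Rightarrow> 'a \<Rightarrow>\<^sub>L 'b"
  where "\<And>E. E \<in> U \<Longrightarrow> (f has_derivative f1 E) (at E)" "\<And>E. E \<in> U \<Longrightarrow> f1 differentiable (at E)"
proof
  define f1 where "f1 E = Blinfun (frechet_derivative f (at E))" for E
  have d: "f differentiable (at E)" "(\<lambda>D. dir_deriv f D X) differentiable (at E)" if "E \<in> U" for E X
    using f that by (auto simp: numeral_2_eq_2)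
  show der: "(f has_derivative f1 E) (at E)" if "E \<in> U" for E
  proof -
    have "(f has_derivative frechet_derivative f (at E)) (at E)"
      using d(1)[OF that] by (simp add: frechet_derivative_works)
    then show ?thesis
      by (simp add: f1_def bounded_linear_Blinfun_apply has_derivative_bounded_linear)
  qed
  show "f1 differentiable (at E)" if E: "E \<in> U" for E
  proof (rule differentiable_blinfun_componentwise)
    fix b :: 'a
    obtain D where "((\<lambda>E. dir_deriv f E b) has_derivative D) (at E)"
      using d(2)[OF E] by (auto simp: differentiable_def)
    then have "((\<lambda>E. blinfun_apply (f1 E) b) has_derivative D) (at E)"
      by (rule has_derivative_transform_within_open[OF _ U E]) (rule dir_deriv_eq[OF der])
    then show "(\<lambda>E. blinfun_apply (f1 E) b) differentiable (at E)" by (auto simp: differentiable_def)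
  qed
qed

lemma has_derivative_blinfun_inverse:
  fixes F J :: "'d::real_normed_vector \<Rightarrow> 'a::real_normed_vector \<Rightarrow>\<^sub>L 'a"
  assumes inv: "\<And>x. x \<in> U \<Longrightarrow> J x o\<^sub>L F x = id_blinfun" "\<And>x. x \<in> U \<Longrightarrow> F x o\<^sub>L J x = id_blinfun"
    and F: "\<And>x. x \<in> U \<Longrightarrow> (F has_derivative F' x) (at x)"
    and U: "open U" "x \<in> U"
  shows "(J has_derivative (\<lambda>h. - ((J x o\<^sub>L F' x h) o\<^sub>L J x))) (at x)"
proof (rule bounded_bilinear.has_derivative_resolvent[OF bounded_bilinear_blinfun_compose bounded_bilinear_blinfun_compose])
  fix x y assume "x \<in> U" "y \<in> U"
  have l: "blinfun_apply (J x) (blinfun_apply (F x) v) = v" for v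
    using inv(1)[OF \<open>x \<in> U\<close>] by (metis blinfun_apply_blinfun_compose id_blinfun.rep_eq id_apply)
  have r: "blinfun_apply (F y) (blinfun_apply (J y) v) = v" for v
    using inv(2)[OF \<open>y \<in> U\<close>] by (metis blinfun_apply_blinfun_compose id_blinfun.rep_eq id_apply)
  show "J x - J y = (J x o\<^sub>L (F y - F x)) o\<^sub>L J y"
    by (rule blinfun_eqI) (simp add: blinfun.bilinear_simps l r)
next
  show "continuous_on U F"
    using F has_derivative_continuous by (blast intro: continuous_at_imp_continuous_on)
qed (use F U in auto)

section \<open>Positive definite matrices\<close>

text \<open>The minimum \<open>c\<close> of the quadratic form on the unit sphere is an eigenvalue,
  hence positive, and it bounds the form from below.\<close>

lemma positive_definite_if_eigenvalues_positive:
  fixes L :: "'a::euclidean_space \<Rightarrow> 'a"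
  assumes L: "linear L" and self: "\<And>x y. L x \<bullet> y = x \<bullet> L y"
    and pos: "\<And>c x. x \<noteq> 0 \<Longrightarrow> L x = c *\<^sub>R x \<Longrightarrow> c > 0"
    and x: "x \<noteq> 0"
  shows "L x \<bullet> x > 0"
proof -
  interpret L: linear L by fact
  have "compact (sphere (0::'a) 1)" by simp
  moreover have "sgn x \<in> sphere 0 1" using x by (simp add: norm_sgn)
  then have "sphere (0::'a) 1 \<noteq> {}" by blast
  moreover have "continuous_on (sphere 0 1) (\<lambda>y. L y \<bullet> y)"
    using linear_continuous_on[OF linear_conv_bounded_linear[THEN iffD1, OF L]] by (intro continuous_intros)
  ultimately obtain z where z: "z \<in> sphere 0 1" "\<And>y. y \<in> sphere 0 1 \<Longrightarrow> L z \<bullet> z \<le> L y \<bullet> y"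
    using continuous_attains_inf[of "sphere 0 1" "\<lambda>y. L y \<bullet> y"] by blast
  define c where "c = L z \<bullet> z"
  have ge: "c * (y \<bullet> y) \<le> L y \<bullet> y" for y
  proof (cases "y = 0")
    case False
    have "c \<le> L (sgn y) \<bullet> sgn y" unfolding c_def using False by (intro z) (simp add: norm_sgn)
    also have "\<dots> = (L y \<bullet> y) / (norm y)\<^sup>2"
      by (simp add: sgn_div_norm L.scaleR power2_eq_square field_simps)
    finally show ?thesis using False by (simp add: field_simps power2_norm_eq_inner)
  qed (simp add: L.zero)
  define K where "K y = L y - c *\<^sub>R y" for y
  have K_nonneg: "K y \<bullet> y \<ge> 0" for y using ge[of y] by (simp add: K_def inner_diff_left)
  have Kz: "K z \<bullet> z = 0" using z(1) by (simp add: K_def inner_diff_left c_def norm_eq_1)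
  have "K z = 0"
  \<comment> \<open>If \<open>K z\<close> were nonzero, a small step from the minimiser along
    \<open>- K z\<close> would make the nonnegative form of \<open>K\<close> negative: its value is
    \<open>- 2 * t * (w \<bullet> w) + t\<^sup>2 * (K w \<bullet> w)\<close>.\<close>
  proof (rule ccontr)
    assume "K z \<noteq> 0"
    define w where "w = K z"
    have w: "w \<bullet> w > 0" using \<open>K z \<noteq> 0\<close> by (simp add: w_def)
    define t where "t = (w \<bullet> w) / (\<bar>K w \<bullet> w\<bar> + 1)"
    have t: "t > 0" "t * (K w \<bullet> w) < w \<bullet> w"
    proof -
      show "t > 0" using w by (simp add: t_def)
      then have "t * (K w \<bullet> w) < t * (\<bar>K w \<bullet> w\<bar> + 1)" by (intro mult_strict_left_mono) auto
      also have "\<dots> = w \<bullet> w" by (simp add: t_def)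
      finally show "t * (K w \<bullet> w) < w \<bullet> w" .
    qed
    have Kw: "K w \<bullet> z = w \<bullet> w"
      using self[of w z] by (simp add: K_def inner_diff_left inner_diff_right w_def[symmetric])
         (simp add: w_def K_def inner_diff_right)
    have K_diff: "K (z - t *\<^sub>R w) = w - t *\<^sub>R K w"
      by (simp add: w_def K_def L.diff L.add L.scaleR algebra_simps)
    have wz: "w \<bullet> z = 0" using Kz by (simp add: w_def)
    have "K (z - t *\<^sub>R w) \<bullet> (z - t *\<^sub>R w) = - t * (w \<bullet> w) - t * (w \<bullet> w) + t * (t * (K w \<bullet> w))"
      unfolding K_diff using wz Kw by (simp add: inner_diff_left inner_diff_right algebra_simps)
    also have "\<dots> = t * (t * (K w \<bullet> w) - w \<bullet> w) - t * (w \<bullet> w)"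
      by (simp add: algebra_simps)
    also have "\<dots> < 0"
      using t w mult_pos_neg[of t "t * (K w \<bullet> w) - w \<bullet> w"] mult_pos_pos[of t "w \<bullet> w"] by linarith
    finally show False using K_nonneg[of "z - t *\<^sub>R w"] by simp
  qed
  then have "c > 0" using z(1) by (intro pos[of z]) (auto simp: K_def)
  then have "c * (x \<bullet> x) > 0" using x by simp
  with ge[of x] show ?thesis by linarith
qed

section \<open>Matrix algebra and the projection onto symmetric matrices\<close>

lemma bounded_bilinear_matrix_mult:
  "bounded_bilinear ((**) :: real^'n^'m \<Rightarrow> real^'p^'n \<Rightarrow> real^'p^'m)"
  unfolding bilinear_conv_bounded_bilinear[symmetric] bilinear_def
  by (auto intro!: linearI simp: matrix_matrix_mult_def vec_eq_iff sum.distrib sum_distrib_left algebra_simps)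

interpretation matrix_mult: bounded_bilinear "(**) :: real^'n^'m \<Rightarrow> real^'p^'n \<Rightarrow> real^'p^'m"
  by (rule bounded_bilinear_matrix_mult)

lemma matrix_inv_eqI:
  fixes A :: "real^'n^'n"
  assumes "A ** B = mat 1" "B ** A = mat 1"
  shows "matrix_inv A = B"
proof -
  have "A ** matrix_inv A = mat 1 \<and> matrix_inv A ** A = mat 1"
    unfolding matrix_inv_def by (rule someI[of _ B]) (use assms in simp)
  then have "matrix_inv A = (B ** A) ** matrix_inv A" and "B ** (A ** matrix_inv A) = B"
    using assms by auto
  then show ?thesis by (simp add: matrix_mul_assoc)
qed

lemma linear_mat_of: "linear mat_of"
  by (rule linearI) (simp_all add: plus_sym.rep_eq scaleR_sym.rep_eq)

lemmas bounded_linear_mat_of = linear_mat_of[THEN linear_conv_bounded_linear[THEN iffD1]]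

text \<open>\<open>sym_of\<close> is unspecified off the symmetric matrices. This projection agrees
  with it there and is linear everywhere, so derivatives and integrals pass through it.\<close>

lift_definition sym_part :: "real^'n^'n \<Rightarrow> 'n::finite sym" is "\<lambda>A. (1/2) *\<^sub>R (A + transpose A)"
  by (simp add: transpose_def vec_eq_iff)

lemma linear_sym_part: "linear sym_part"
  by (rule linearI; transfer) (simp_all add: transpose_def vec_eq_iff algebra_simps)

lemmas bounded_linear_sym_part = linear_sym_part[THEN linear_conv_bounded_linear[THEN iffD1]]

lemma sym_of_eq_sym_part: "transpose A = A \<Longrightarrow> sym_of A = sym_part A"
  by (simp add: sym_part_def flip: scaleR_2)

lemma mat_of_sym_part: "transpose A = A \<Longrightarrow> mat_of (sym_part A) = A"
  by (simp add: sym_part.rep_eq flip: scaleR_2)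

lemma trace_transpose: "trace (transpose A) = trace A"
  by (simp add: trace_def transpose_def)

lemma trace_scaleR: "trace (c *\<^sub>R A :: real^'n^'n) = c * trace A"
  by (simp add: trace_def sum_distrib_left)

text \<open>The antisymmetric part of \<open>A\<close> is trace-orthogonal to every symmetric
  matrix.\<close>

lemma inner_sym_part: "sym_part A \<bullet> Y = trace (A ** mat_of Y)"
proof -
  have "trace (transpose A ** mat_of Y) = trace (A ** mat_of Y)"
    by (metis matrix_transpose_mul trace_mul_sym trace_transpose transpose_mat_of transpose_transpose)
  then show ?thesis
    by (simp add: inner_sym_def sym_part.rep_eq matrix_mult.scaleR_left matrix_mult.add_left trace_add trace_scaleR)
qed

section \<open>The cone of positive definite matrices\<close>

lemma posdef_iff_sphere: "posdef = {D. \<forall>x\<in>sphere 0 1. 0 < x \<bullet> (mat_of D *v x)}"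
proof -
  have "0 < x \<bullet> (mat_of D *v x)" if *: "\<forall>x\<in>sphere 0 1. 0 < x \<bullet> (mat_of D *v x)" and "x \<noteq> 0" for D x
  proof -
    have "0 < sgn x \<bullet> (mat_of D *v sgn x)" using that by (simp add: norm_sgn)
    also have "\<dots> = (x \<bullet> (mat_of D *v x)) / (norm x)\<^sup>2"
      by (simp add: sgn_div_norm matrix_vector_mult_scaleR power2_eq_square field_simps)
    finally show ?thesis using \<open>x \<noteq> 0\<close> by (simp add: zero_less_divide_iff)
  qed
  moreover have "x \<noteq> 0" if "x \<in> sphere 0 1" for x :: "real^'n" using that by auto
  ultimately show ?thesis unfolding posdef_def by (intro Collect_cong) blast
qed

text \<open>The complement is the projection of a closed set along the unit sphere, and projection
  along a compact factor preserves closedness.\<close>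

lemma open_posdef: "open (posdef :: 'n::finite sym set)"
proof -
  have "continuous_on UNIV (\<lambda>p. fst p \<bullet> (mat_of (snd p :: 'n sym) *v fst p))"
    unfolding matrix_vector_mult_def
    by (intro continuous_intros bounded_linear.continuous_on[OF bounded_linear_mat_of])
  then have "closed {p. fst p \<bullet> (mat_of (snd p :: 'n sym) *v fst p) \<le> 0}"
    by (intro closed_Collect_le continuous_on_const)
  then have "closed {D. \<exists>x. x \<in> sphere 0 1 \<and> (x, D) \<in> {p. fst p \<bullet> (mat_of (snd p :: 'n sym) *v fst p) \<le> 0}}"
    by (intro closed_compact_projection) simp
  also have "\<dots> = - posdef" unfolding posdef_iff_sphere by (simp add: set_eq_iff not_less Bex_def)
  finally show ?thesis by (simp add: closed_def)
qed

text \<open>Convexity serves both the Leibniz rule and the segments joining \<open>D\<close> to the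
  identity.\<close>

lemma convex_posdef: "convex posdef"
proof (rule convexI)
  fix D E :: "'n::finite sym" and u v :: real
  assume DE: "D \<in> posdef" "E \<in> posdef" and uv: "0 \<le> u" "0 \<le> v" "u + v = 1"
  have "0 < x \<bullet> (mat_of (u *\<^sub>R D + v *\<^sub>R E) *v x)" if "x \<noteq> 0" for x
  proof -
    have "0 < x \<bullet> (mat_of D *v x)" "0 < x \<bullet> (mat_of E *v x)" using DE that by (auto simp: posdef_def)
    then have "0 < u * (x \<bullet> (mat_of D *v x)) + v * (x \<bullet> (mat_of E *v x))"
      using uv by (cases "u = 0") (auto intro: add_pos_nonneg)
    then show ?thesis
      by (simp add: plus_sym.rep_eq scaleR_sym.rep_eq matrix_vector_mult_add_rdistrib inner_add_right
          flip: scaleR_matrix_vector_assoc)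
  qed
  then show "u *\<^sub>R D + v *\<^sub>R E \<in> posdef" by (simp add: posdef_def)
qed

lemma posdef_matrix_inv:
  assumes "D \<in> posdef"
  shows "mat_of D ** matrix_inv (mat_of D) = mat 1" "matrix_inv (mat_of D) ** mat_of D = mat 1"
proof -
  have "\<forall>x. mat_of D *v x = 0 \<longrightarrow> x = 0" using assms by (force simp: posdef_def)
  then have "\<exists>B. B ** mat_of D = mat 1" using matrix_left_invertible_ker by blast
  then obtain B where "B ** mat_of D = mat 1" "mat_of D ** B = mat 1" using matrix_left_right_inverse by blast
  then show "mat_of D ** matrix_inv (mat_of D) = mat 1" "matrix_inv (mat_of D) ** mat_of D = mat 1"
    using matrix_inv_eqI by auto
qed

lemma transpose_matrix_inv_posdef:
  assumes "D \<in> posdef"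
  shows "transpose (matrix_inv (mat_of D)) = matrix_inv (mat_of D)"
  using posdef_matrix_inv[OF assms]
  by (intro matrix_inv_eqI[symmetric]) (metis matrix_transpose_mul transpose_mat transpose_mat_of)+

text \<open>The i-th diagonal entry is the form of \<open>A\<close> on the i-th row of
  \<open>X\<close>, and some row is nonzero.\<close>

lemma trace_congruence_pos:
  fixes X :: "'n::finite sym" and A :: "real^'n^'n"
  assumes A: "\<And>x. x \<noteq> 0 \<Longrightarrow> 0 < x \<bullet> (A *v x)" and X: "X \<noteq> 0"
  shows "0 < trace (mat_of X ** A ** mat_of X)"
proof -
  have eq: "(mat_of X ** A ** mat_of X) $ i $ i = mat_of X $ i \<bullet> (A *v (mat_of X $ i))" for i
    by (simp add: matrix_matrix_mult_def matrix_vector_mult_def inner_vec_def sum_distrib_left sum_distrib_right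
        mat_of_nth_commute[of X _ i] mult.assoc) (rule sum.swap)
  have "mat_of X \<noteq> 0" using X by (metis mat_of_inject zero_sym.rep_eq)
  then obtain i where i: "mat_of X $ i \<noteq> 0" by (auto simp: vec_eq_iff)
  have "0 \<le> mat_of X $ j \<bullet> (A *v (mat_of X $ j))" for j
    using A[of "mat_of X $ j"] by (cases "mat_of X $ j = 0") auto
  then show ?thesis
    unfolding trace_def eq by (intro sum_pos2[of UNIV i] A i) auto
qed

text \<open>With \<open>J = M\<inverse>\<close>, an eigenvalue equation \<open>J X J = c X\<close> gives \<open>Tr (X J X) = c Tr (X M X)\<close>, and both
  traces are positive. This avoids square roots of matrices.\<close>

lemma conjugation_positive_definite:
  fixes M X :: "'n::finite sym"
  assumes M: "M \<in> posdef" and X: "X \<noteq> 0"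
  shows "0 < sym_part (matrix_inv (mat_of M) ** mat_of X ** matrix_inv (mat_of M)) \<bullet> X"
proof -
  define J where "J = matrix_inv (mat_of M)"
  have JM: "mat_of M ** J = mat 1" "J ** mat_of M = mat 1" and JT: "transpose J = J"
    unfolding J_def using posdef_matrix_inv[OF M] transpose_matrix_inv_posdef[OF M] by auto
  have Jpos: "0 < x \<bullet> (J *v x)" if "x \<noteq> 0" for x
  proof -
    have x: "x = mat_of M *v (J *v x)" by (simp add: matrix_vector_mul_assoc JM)
    then have "J *v x \<noteq> 0" using that by (metis matrix_vector_mult_0_right)
    then have "0 < (J *v x) \<bullet> (mat_of M *v (J *v x))" using M by (simp add: posdef_def)
    then show ?thesis using x by (simp add: inner_commute)
  qed
  define L where "L = (\<lambda>X. sym_part (J ** mat_of X ** J))"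
  have symL: "transpose (J ** mat_of X ** J) = J ** mat_of X ** J" for X :: "'n sym"
    by (simp add: matrix_transpose_mul JT matrix_mul_assoc)
  have "L X \<bullet> X > 0"
  proof (rule positive_definite_if_eigenvalues_positive[OF _ _ _ X])
    show "linear L"
      unfolding L_def
      by (rule linearI)
        (simp_all add: plus_sym.rep_eq scaleR_sym.rep_eq matrix_mult.add_left matrix_mult.add_right
          matrix_mult.scaleR_left matrix_mult.scaleR_right linear_add[OF linear_sym_part] linear_cmul[OF linear_sym_part])
    show "L X \<bullet> Y = X \<bullet> L Y" for X Y
      unfolding L_def inner_commute[of X] inner_sym_part
      by (metis matrix_mul_assoc trace_mul_sym)
    fix c and X :: "'n sym"
    assume X: "X \<noteq> 0" and "L X = c *\<^sub>R X"
    then have "mat_of (L X) = c *\<^sub>R mat_of X" by (simp add: scaleR_sym.rep_eq)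
    then have "J ** mat_of X ** J = c *\<^sub>R mat_of X" by (simp add: L_def mat_of_sym_part symL)
    \<comment> \<open>Multiplying by \<open>M\<close> cancels the left \<open>J\<close>. A further
      \<open>X\<close> on the left and cyclicity of the trace then produce the two positive
      traces.\<close>
    then have "mat_of M ** (J ** mat_of X ** J) = c *\<^sub>R (mat_of M ** mat_of X)" by (simp add: matrix_mult.scaleR_right)
    then have "mat_of X ** J = c *\<^sub>R (mat_of M ** mat_of X)" by (simp add: matrix_mul_assoc JM)
    then have "mat_of X ** (mat_of X ** J) = c *\<^sub>R (mat_of X ** mat_of M ** mat_of X)"
      by (simp add: matrix_mult.scaleR_right matrix_mul_assoc)
    moreover have "trace (mat_of X ** (mat_of X ** J)) = trace (mat_of X ** J ** mat_of X)"
      by (rule trace_mul_sym)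
    ultimately have "trace (mat_of X ** J ** mat_of X) = c * trace (mat_of X ** mat_of M ** mat_of X)"
      by (simp add: trace_scaleR)
    moreover have "0 < trace (mat_of X ** J ** mat_of X)" "0 < trace (mat_of X ** mat_of M ** mat_of X)"
      using M by (auto intro!: trace_congruence_pos X Jpos simp: posdef_def)
    ultimately show "c > 0" by (simp add: zero_less_mult_iff)
  qed
  then show ?thesis by (simp add: L_def J_def)
qed

section \<open>The metric as an integral over the unit interval\<close>

text \<open>The factor \<open>(1 - u)\<^sup>2\<close> in \<open>fg\<close> cancels the Jacobian of
  \<open>t = u / (1 - u)\<close>. Continuity of \<open>g\<close> up to \<open>u = 1\<close>, the
  image of infinity, makes the improper integral converge.\<close>

lemma has_integral_half_line_substitution:
  fixes f g :: "real \<Rightarrow> 'b::euclidean_space"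
  assumes g: "continuous_on {0..1} g"
    and fg: "\<And>u. 0 \<le> u \<Longrightarrow> u < 1 \<Longrightarrow> f (u / (1 - u)) = (1 - u)\<^sup>2 *\<^sub>R g u"
  shows "(f has_integral integral {0..1} g) {0..}"
proof -
  have img: "(\<lambda>u. u / (1 - u)) ` {0..<1::real} = {0..}"
  proof (intro set_eqI iffI)
    fix t :: real assume "t \<in> {0..}"
    then have "t = (t / (1 + t)) / (1 - t / (1 + t))" "t / (1 + t) \<in> {0..<1}"
      by (auto simp: field_simps)
    then show "t \<in> (\<lambda>u. u / (1 - u)) ` {0..<1::real}" by blast
  qed auto
  have inj: "inj_on (\<lambda>u. u / (1 - u)) {0..<1::real}"
    by (auto simp: inj_on_def field_simps)
  have der: "((\<lambda>u. u / (1 - u)) has_field_derivative 1 / (1 - u)\<^sup>2) (at u within {0..<1})" if "u \<in> {0..<1}" for u :: real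
    using that by (auto intro!: derivative_eq_intros simp: power2_eq_square field_simps)
  have "((\<lambda>t. f t \<bullet> b) has_integral integral {0..1} g \<bullet> b) {0..}" for b
  proof -
    let ?gb = "\<lambda>u. g u \<bullet> b"
    have gb: "?gb absolutely_integrable_on {0..1}"
      by (intro absolutely_integrable_continuous_real continuous_intros g)
    have gb': "?gb absolutely_integrable_on {0..<1}"
      by (rule set_integrable_subset[OF gb]) auto
    have "(?gb has_integral integral {0..1} ?gb) {0..1}"
      using gb by (simp add: absolutely_integrable_on_def integrable_integral)
    \<comment> \<open>The endpoint 1 corresponds to no finite \<open>t\<close>; it is dropped as a
      null set.\<close>
    then have "(?gb has_integral integral {0..1} ?gb) {0..<1}"
      by (subst has_integral_spike_set_eq[where T = "{0..1}"]) (auto intro: negligible_subset[OF negligible_sing[of 1]])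
    then have int: "integral {0..<1} ?gb = integral {0..1} g \<bullet> b"
      using g by (simp add: integral_unique integrable_continuous_real)
    have eq: "?gb u = \<bar>1 / (1 - u)\<^sup>2\<bar> * (f (u / (1 - u)) \<bullet> b)" if "u \<in> {0..<1}" for u
      using that by (simp add: fg)
    have "(\<lambda>u. \<bar>1 / (1 - u)\<^sup>2\<bar> * (f (u / (1 - u)) \<bullet> b)) absolutely_integrable_on {0..<1}"
      by (subst set_integrable_cong[OF refl refl eq[symmetric]]) (use gb' in simp_all)
    moreover have "integral {0..<1} (\<lambda>u. \<bar>1 / (1 - u)\<^sup>2\<bar> * (f (u / (1 - u)) \<bullet> b)) = integral {0..1} g \<bullet> b"
      unfolding int[symmetric] by (rule integral_cong) (rule eq[symmetric])
    ultimately have "(\<lambda>t. f t \<bullet> b) absolutely_integrable_on {0..} \<and> integral {0..} (\<lambda>t. f t \<bullet> b) = integral {0..1} g \<bullet> b"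
      using has_absolute_integral_change_of_variables_1'[OF _ der inj, where f = "\<lambda>t. f t \<bullet> b" and b = "integral {0..1} g \<bullet> b"]
      unfolding img by simp
    then show ?thesis
      by (metis absolutely_integrable_on_def integrable_integral)
  qed
  then show ?thesis using has_integral_componentwise_iff by blast
qed

text \<open>The substitution \<open>t = u / (1 - u)\<close> moves the integral over \<open>[0, \<infinity>)\<close> to \<open>[0, 1]\<close> and turns the
  resolvents of \<open>D\<close> into the inverses of the points of the segment from \<open>D\<close> to the identity.\<close>

definition segment_inv :: "'n::finite sym \<Rightarrow> real \<Rightarrow> real^'n^'n" where
  "segment_inv D u = matrix_inv (mat_of ((1 - u) *\<^sub>R D + u *\<^sub>R sym_of (mat 1)))"

lemma mat_of_sym_of_mat_1: "mat_of (sym_of (mat 1)) = mat 1"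
  by (simp add: sym_of_inverse)

lemma segment_posdef:
  assumes "D \<in> posdef" "u \<in> {0..1}"
  shows "(1 - u) *\<^sub>R D + u *\<^sub>R sym_of (mat 1) \<in> posdef"
  using convexD[OF convex_posdef assms(1), of "sym_of (mat 1)" "1 - u" u] assms
  by (simp add: posdef_def mat_of_sym_of_mat_1)

text \<open>\<open>D + u / (1 - u)\<close> is the segment point divided by \<open>1 - u\<close>.
  Each resolvent thus contributes one factor \<open>1 - u\<close>, and two of them absorb the
  Jacobian.\<close>

lemma resolvent_eq_segment_inv:
  assumes D: "D \<in> posdef" and u: "0 \<le> u" "u < 1"
  shows "resolvent D (u / (1 - u)) = (1 - u) *\<^sub>R segment_inv D u"
proof -
  let ?M = "mat_of ((1 - u) *\<^sub>R D + u *\<^sub>R sym_of (mat 1))"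
  have "mat (u / (1 - u)) = (u / (1 - u)) *\<^sub>R (mat 1 :: real^'a^'a)"
    by (simp add: mat_def vec_eq_iff)
  then have "mat_of D + mat (u / (1 - u)) = (1 / (1 - u)) *\<^sub>R ?M"
    using u by (simp add: plus_sym.rep_eq scaleR_sym.rep_eq mat_of_sym_of_mat_1 scaleR_add_right)
  moreover have "matrix_inv ((1 / (1 - u)) *\<^sub>R ?M) = (1 - u) *\<^sub>R segment_inv D u"
    using u posdef_matrix_inv[OF segment_posdef[OF D, of u]]
    by (intro matrix_inv_eqI) (simp_all add: segment_inv_def matrix_mult.scaleR_left matrix_mult.scaleR_right)
  ultimately show ?thesis by (simp add: resolvent_def)
qed

lemma transpose_segment_inv:
  "D \<in> posdef \<Longrightarrow> u \<in> {0..1} \<Longrightarrow> transpose (segment_inv D u) = segment_inv D u"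
  unfolding segment_inv_def by (intro transpose_matrix_inv_posdef segment_posdef)

text \<open>Different parameters \<open>u\<close> and \<open>v\<close> are allowed for the sake of
  joint continuity; equal ones give the derivative in \<open>D\<close>.\<close>

lemma segment_inv_resolvent_identity:
  assumes "D \<in> posdef" "u \<in> {0..1}" "E \<in> posdef" "v \<in> {0..1}"
  shows "segment_inv D u - segment_inv E v =
    segment_inv D u ** (mat_of ((1 - v) *\<^sub>R E + v *\<^sub>R sym_of (mat 1)) - mat_of ((1 - u) *\<^sub>R D + u *\<^sub>R sym_of (mat 1)))
      ** segment_inv E v"
proof -
  let ?M = "mat_of ((1 - u) *\<^sub>R D + u *\<^sub>R sym_of (mat 1))" and ?N = "mat_of ((1 - v) *\<^sub>R E + v *\<^sub>R sym_of (mat 1))"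
  have "segment_inv D u ** ?M = mat 1" "?N ** segment_inv E v = mat 1"
    unfolding segment_inv_def using assms by (auto intro!: posdef_matrix_inv segment_posdef)
  then show ?thesis
    by (simp add: matrix_mult.diff_left matrix_mult.diff_right flip: matrix_mul_assoc)
qed

lemma continuous_on_segment_inv:
  "continuous_on (posdef \<times> {0..1}) (\<lambda>p. segment_inv (fst p) (snd p))"
proof (rule matrix_mult.continuous_on_resolvent[OF bounded_bilinear_matrix_mult,
      where F = "\<lambda>p. mat_of ((1 - snd p) *\<^sub>R fst p + snd p *\<^sub>R sym_of (mat 1))"])
  show "continuous_on (posdef \<times> {0..1}) (\<lambda>p. mat_of ((1 - snd p) *\<^sub>R fst p + snd p *\<^sub>R sym_of (mat 1)))"
    by (intro bounded_linear.continuous_on[OF bounded_linear_mat_of] continuous_intros)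
qed (auto intro!: segment_inv_resolvent_identity)

lemma has_derivative_segment_inv:
  assumes D: "D \<in> posdef" and u: "u \<in> {0..1}"
  shows "((\<lambda>E. segment_inv E u) has_derivative
    (\<lambda>H. - (1 - u) *\<^sub>R (segment_inv D u ** mat_of H ** segment_inv D u))) (at D)"
proof -
  let ?F = "\<lambda>E. mat_of ((1 - u) *\<^sub>R E + u *\<^sub>R sym_of (mat 1))"
  have F: "(?F has_derivative (\<lambda>H. mat_of ((1 - u) *\<^sub>R H))) (at E)" for E
    by (intro bounded_linear.has_derivative[OF bounded_linear_mat_of]) (auto intro!: derivative_eq_intros)
  have "((\<lambda>E. segment_inv E u) has_derivative
    (\<lambda>H. - (segment_inv D u ** mat_of ((1 - u) *\<^sub>R H) ** segment_inv D u))) (at D)"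
  proof (rule matrix_mult.has_derivative_resolvent[OF bounded_bilinear_matrix_mult _ _ F open_posdef D])
    show "continuous_on posdef ?F"
      by (intro bounded_linear.continuous_on[OF bounded_linear_mat_of] continuous_intros)
  qed (use u in \<open>auto intro!: segment_inv_resolvent_identity\<close>)
  then show ?thesis
    by (simp only: scaleR_sym.rep_eq matrix_mult.scaleR_left matrix_mult.scaleR_right scaleR_minus_left)
qed

section \<open>The transformed integrand and its derivatives\<close>

definition metric_integrand :: "'n::finite sym \<Rightarrow> 'n sym \<Rightarrow> real \<Rightarrow> 'n sym" where
  "metric_integrand D X u = sym_part (segment_inv D u ** mat_of X ** segment_inv D u)"

text \<open>Derivative of \<open>metric_integrand\<close> in direction \<open>X\<close>, applied to
  \<open>Y\<close>. Three resolvents supply \<open>(1 - u)\<close> cubed, of which the Jacobian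
  cancels two powers.\<close>

definition metric_integrand1 :: "'n::finite sym \<Rightarrow> 'n sym \<Rightarrow> 'n sym \<Rightarrow> real \<Rightarrow> 'n sym" where
  "metric_integrand1 D X Y u = - (1 - u) *\<^sub>R sym_part
    (segment_inv D u ** mat_of X ** segment_inv D u ** mat_of Y ** segment_inv D u
      + segment_inv D u ** mat_of Y ** segment_inv D u ** mat_of X ** segment_inv D u)"

lemma metric_integrand1_commute: "metric_integrand1 D X Y u = metric_integrand1 D Y X u"
  by (simp add: metric_integrand1_def add.commute)

lemma has_derivative_metric_integrand:
  assumes D: "D \<in> posdef" and u: "u \<in> {0..1}"
  shows "((\<lambda>E. metric_integrand E X u) has_derivative (\<lambda>H. metric_integrand1 D H X u)) (at D)"
proof -
  note J = has_derivative_segment_inv[OF D u]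
  have "((\<lambda>E. metric_integrand E X u) has_derivative
     (\<lambda>H. sym_part (segment_inv D u ** mat_of X ** (- (1 - u) *\<^sub>R (segment_inv D u ** mat_of H ** segment_inv D u))
      + (- (1 - u) *\<^sub>R (segment_inv D u ** mat_of H ** segment_inv D u)) ** mat_of X ** segment_inv D u))) (at D)"
    unfolding metric_integrand_def
    by (intro bounded_linear.has_derivative[OF bounded_linear_sym_part] matrix_mult.FDERIV J
        bounded_linear.has_derivative[OF matrix_mult.bounded_linear_left])
  then show ?thesis
    by (subst metric_integrand1_commute)
      (simp only: metric_integrand1_def matrix_mult.scaleR_left matrix_mult.scaleR_right matrix_mul_assoc
        scaleR_add_right[symmetric] linear_cmul[OF linear_sym_part])
qed

lemma continuous_on_segment_inv_snd: "D \<in> posdef \<Longrightarrow> continuous_on {0..1} (segment_inv D)"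
  using continuous_on_compose2[OF continuous_on_segment_inv, of "{0..1}" "Pair D"]
  by (simp add: image_subset_iff continuous_on_Pair)

lemma continuous_on_metric_integrand: "D \<in> posdef \<Longrightarrow> continuous_on {0..1} (metric_integrand D X)"
  unfolding metric_integrand_def
  by (intro bounded_linear.continuous_on[OF bounded_linear_sym_part] matrix_mult.continuous_on
      continuous_on_const continuous_on_segment_inv_snd)

lemma continuous_on_metric_integrand1:
  "continuous_on (posdef \<times> {0..1}) (\<lambda>p. metric_integrand1 (fst p) X Y (snd p))"
  unfolding metric_integrand1_def
  by (intro continuous_on_scaleR continuous_on_minus continuous_on_diff continuous_on_add continuous_on_snd continuous_on_id
      bounded_linear.continuous_on[OF bounded_linear_sym_part] matrix_mult.continuous_on
      continuous_on_const continuous_on_segment_inv)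

lemma continuous_on_metric_integrand1_snd:
  "D \<in> posdef \<Longrightarrow> continuous_on {0..1} (metric_integrand1 D X Y)"
  using continuous_on_compose2[OF continuous_on_metric_integrand1, of "{0..1}" "Pair D"]
  by (simp add: image_subset_iff continuous_on_Pair)

lemma has_derivative_integral_metric_integrand:
  assumes "D \<in> posdef"
  shows "((\<lambda>E. integral {0..1} (metric_integrand E X)) has_derivative
    (\<lambda>H. integral {0..1} (metric_integrand1 D H X))) (at D)"
  by (rule has_derivative_integral_componentwise[OF open_posdef convex_posdef assms])
    (auto intro!: has_derivative_metric_integrand continuous_on_metric_integrand continuous_on_metric_integrand1)

text \<open>This makes \<open>G\<close> twice differentiable. Mere existence is recorded, because
  the second derivative of \<open>G\<close> cancels in the curvature by symmetry.\<close>

lemma differentiable_integral_metric_integrand1: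
  fixes D X Y :: "'n::finite sym"
  assumes D: "D \<in> posdef"
  shows "(\<lambda>E. integral {0..1} (metric_integrand1 E X Y)) differentiable (at D)"
proof -
  define J' where "J' E H u = - (1 - u) *\<^sub>R (segment_inv E u ** mat_of H ** segment_inv E u)" for E H :: "'n sym" and u
  \<comment> \<open>Product rule for the five factors J A J B J, where \<open>J'\<close> is the
    derivative of J = \<open>segment_inv\<close> in direction \<open>H\<close>.\<close>
  define W where "W A B E H u = segment_inv E u ** mat_of A ** segment_inv E u ** mat_of B ** J' E H u
      + (segment_inv E u ** mat_of A ** J' E H u + J' E H u ** mat_of A ** segment_inv E u) ** mat_of B ** segment_inv E u"
    for A B E H :: "'n sym" and u
  have W: "((\<lambda>E. segment_inv E u ** mat_of A ** segment_inv E u ** mat_of B ** segment_inv E u)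
      has_derivative (\<lambda>H. W A B E H u)) (at E)" if "E \<in> posdef" "u \<in> {0..1}" for A B E and u
    unfolding W_def J'_def
    by (intro matrix_mult.FDERIV has_derivative_segment_inv that
        bounded_linear.has_derivative[OF matrix_mult.bounded_linear_left])
  have cW: "continuous_on (posdef \<times> {0..1}) (\<lambda>p. W A B (fst p) H (snd p))" for A B H
    unfolding W_def J'_def
    by (intro continuous_on_scaleR continuous_on_minus continuous_on_diff continuous_on_add continuous_on_snd continuous_on_id
      matrix_mult.continuous_on continuous_on_const continuous_on_segment_inv)
  have "((\<lambda>E. integral {0..1} (metric_integrand1 E X Y)) has_derivative
    (\<lambda>H. integral {0..1} (\<lambda>u. - (1 - u) *\<^sub>R sym_part (W X Y D H u + W Y X D H u)))) (at D)"
  proof (rule has_derivative_integral_componentwise[OF open_posdef convex_posdef D])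
    fix E :: "'n sym" and u :: real assume "E \<in> posdef" "u \<in> {0..1}"
    then show "((\<lambda>E. metric_integrand1 E X Y u) has_derivative
        (\<lambda>H. - (1 - u) *\<^sub>R sym_part (W X Y E H u + W Y X E H u))) (at E)"
      unfolding metric_integrand1_def
      by (intro has_derivative_scaleR_right bounded_linear.has_derivative[OF bounded_linear_sym_part]
          has_derivative_add W)
  next
    show "continuous_on (posdef \<times> {0..1}) (\<lambda>p. - (1 - snd p) *\<^sub>R sym_part (W X Y (fst p) H (snd p) + W Y X (fst p) H (snd p)))" for H
      by (intro continuous_on_scaleR continuous_on_minus continuous_on_diff continuous_on_add continuous_on_snd continuous_on_id
        bounded_linear.continuous_on[OF bounded_linear_sym_part] continuous_on_const cW)
  qed (rule continuous_on_metric_integrand1_snd)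
  then show ?thesis by (auto simp: differentiable_def)
qed

section \<open>The Christoffel form and the curvature\<close>

lemma sym_of_resolvent:
  assumes D: "D \<in> posdef" and t: "t \<ge> 0"
  shows "sym_of (resolvent D t ** mat_of X ** resolvent D t) \<bullet> Y
    = trace (resolvent D t ** mat_of X ** resolvent D t ** mat_of Y)"
proof -
  define u where "u = t / (1 + t)"
  have u: "0 \<le> u" "u < 1" "t = u / (1 - u)" using t by (auto simp: u_def field_simps)
  have "transpose (resolvent D t) = resolvent D t"
    unfolding u(3) resolvent_eq_segment_inv[OF D u(1,2)] using transpose_segment_inv[OF D, of u] u
    by (simp add: transpose_scalar)
  then have "transpose (resolvent D t ** mat_of X ** resolvent D t) = resolvent D t ** mat_of X ** resolvent D t"
    by (simp add: matrix_transpose_mul matrix_mul_assoc)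
  then show ?thesis by (simp add: sym_of_eq_sym_part inner_sym_part)
qed

lemma has_integral_resolvent:
  assumes D: "D \<in> posdef"
  shows "((\<lambda>t. sym_of (resolvent D t ** mat_of X ** resolvent D t)) has_integral
    integral {0..1} (metric_integrand D X)) {0..}"
proof (rule has_integral_half_line_substitution[OF continuous_on_metric_integrand[OF D]])
  fix u :: real assume u: "0 \<le> u" "u < 1"
  have "transpose (segment_inv D u ** mat_of X ** segment_inv D u) = segment_inv D u ** mat_of X ** segment_inv D u"
    using transpose_segment_inv[OF D, of u] u by (simp add: matrix_transpose_mul matrix_mul_assoc)
  then have "transpose ((1 - u)\<^sup>2 *\<^sub>R (segment_inv D u ** mat_of X ** segment_inv D u))
      = (1 - u)\<^sup>2 *\<^sub>R (segment_inv D u ** mat_of X ** segment_inv D u)"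
    by (simp add: transpose_scalar)
  moreover have "resolvent D (u / (1 - u)) ** mat_of X ** resolvent D (u / (1 - u))
      = (1 - u)\<^sup>2 *\<^sub>R (segment_inv D u ** mat_of X ** segment_inv D u)"
    by (simp add: resolvent_eq_segment_inv[OF D u] matrix_mult.scaleR_left matrix_mult.scaleR_right power2_eq_square)
  ultimately show "sym_of (resolvent D (u / (1 - u)) ** mat_of X ** resolvent D (u / (1 - u)))
      = (1 - u)\<^sup>2 *\<^sub>R metric_integrand D X u"
    by (simp only: metric_integrand_def sym_of_eq_sym_part linear_cmul[OF linear_sym_part])
qed

text \<open>\<open>Blinfun\<close> has a known value only on bounded linear maps, so linearity of
  the integral in \<open>X\<close> has to be established.\<close>

lemma metric_op_eq_integral:
  assumes D: "D \<in> posdef"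
  shows "blinfun_apply (metric_op D) X = integral {0..1} (metric_integrand D X)"
proof -
  have add: "metric_integrand D (X + Y) u = metric_integrand D X u + metric_integrand D Y u"
    and scale: "metric_integrand D (c *\<^sub>R X) u = c *\<^sub>R metric_integrand D X u" for X Y c u
    by (simp_all add: metric_integrand_def plus_sym.rep_eq scaleR_sym.rep_eq matrix_mult.add_left matrix_mult.add_right
          matrix_mult.scaleR_left matrix_mult.scaleR_right linear_add[OF linear_sym_part] linear_cmul[OF linear_sym_part])
  have int: "metric_integrand D X integrable_on {0..1}" for X
    by (rule integrable_continuous_real[OF continuous_on_metric_integrand[OF D]])
  have "linear (\<lambda>X. integral {0..1} (metric_integrand D X))"
    by (rule linearI) (simp_all add: add scale integral_add int cong: integral_cong)
  then have "bounded_linear (\<lambda>X. integral {0..1} (metric_integrand D X))"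
    by (rule linear_conv_bounded_linear[THEN iffD1])
  then show ?thesis
    unfolding metric_op_def integral_unique[OF has_integral_resolvent[OF D]]
    by (simp add: bounded_linear_Blinfun_apply)
qed

lemma metric_eq_inner:
  assumes D: "D \<in> posdef"
  shows "metric D X Y = blinfun_apply (metric_op D) X \<bullet> Y"
proof -
  have "((\<lambda>t. sym_of (resolvent D t ** mat_of X ** resolvent D t) \<bullet> Y) has_integral
      blinfun_apply (metric_op D) X \<bullet> Y) {0..}"
    using has_integral_linear[OF has_integral_resolvent[OF D] bounded_linear_inner_left]
    by (simp add: o_def metric_op_eq_integral[OF D])
  then have "((\<lambda>t. trace (resolvent D t ** mat_of X ** resolvent D t ** mat_of Y)) has_integral
      blinfun_apply (metric_op D) X \<bullet> Y) {0..}"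
    by (rule has_integral_eq[rotated]) (simp add: sym_of_resolvent[OF D])
  then show ?thesis unfolding metric_def by (rule integral_unique)
qed

lemma metric_op_self_adjoint:
  assumes D: "D \<in> posdef"
  shows "blinfun_apply (metric_op D) X \<bullet> Y = X \<bullet> blinfun_apply (metric_op D) Y"
proof -
  have "trace (R ** A ** R ** B) = trace (R ** B ** R ** A)" for R A B :: "real^'a^'a"
    by (metis matrix_mul_assoc trace_mul_sym)
  then have "metric D X Y = metric D Y X" unfolding metric_def by (intro integral_cong)
  then show ?thesis by (simp add: metric_eq_inner[OF D] inner_commute)
qed

text \<open>The integrand is continuous and positive at every \<open>u\<close>, so its integral
  cannot vanish. Injectivity of \<open>G\<close> follows.\<close>

lemma metric_op_positive_definite:
  assumes D: "D \<in> posdef" and X: "X \<noteq> 0"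
  shows "0 < blinfun_apply (metric_op D) X \<bullet> X"
proof -
  have pos: "0 < metric_integrand D X u \<bullet> X" if "u \<in> {0..1}" for u
    unfolding metric_integrand_def segment_inv_def
    by (rule conjugation_positive_definite[OF segment_posdef[OF D that] X])
  have cont: "continuous_on {0..1} (\<lambda>u. metric_integrand D X u \<bullet> X)"
    by (intro continuous_intros continuous_on_metric_integrand D)
  have "integral {0..1} (\<lambda>u. metric_integrand D X u \<bullet> X) \<noteq> 0"
    using integral_eq_0_iff[OF cont] pos by (force simp: less_imp_le)
  moreover have "integral {0..1} (\<lambda>u. metric_integrand D X u \<bullet> X) \<ge> 0"
    using pos by (intro integral_nonneg integrable_continuous_real cont) (simp add: less_imp_le)
  ultimately show ?thesis
    using integrable_continuous_real[OF continuous_on_metric_integrand[OF D]] by (simp add: metric_op_eq_integral[OF D])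
qed

lemma metric_op_inverse:
  assumes D: "D \<in> posdef"
  shows "metric_op_inv D o\<^sub>L metric_op D = id_blinfun" "metric_op D o\<^sub>L metric_op_inv D = id_blinfun"
proof -
  let ?G = "blinfun_apply (metric_op D)"
  have lin: "linear ?G" by (intro bounded_linear.linear blinfun.bounded_linear_right)
  have inj: "inj ?G"
    unfolding linear_injective_0[OF lin] using metric_op_positive_definite[OF D] by force
  have surj: "surj ?G" by (rule linear_inj_imp_surj[OF lin inj])
  have "bounded_linear (inv ?G)"
    by (rule inj_linear_imp_inv_bounded_linear[OF blinfun.bounded_linear_right inj])
  then have "blinfun_apply (metric_op_inv D) = inv ?G"
    unfolding metric_op_inv_def by (rule bounded_linear_Blinfun_apply)
  then show "metric_op_inv D o\<^sub>L metric_op D = id_blinfun" "metric_op D o\<^sub>L metric_op_inv D = id_blinfun"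
    by (auto intro!: blinfun_eqI simp: inv_f_f[OF inj] surj_f_inv_f[OF surj])
qed

lemma metric_op_inv_metric_op:
  "D \<in> posdef \<Longrightarrow> blinfun_apply (metric_op_inv D) (blinfun_apply (metric_op D) X) = X"
  "D \<in> posdef \<Longrightarrow> blinfun_apply (metric_op D) (blinfun_apply (metric_op_inv D) X) = X"
  by (metis blinfun_apply_blinfun_compose id_blinfun.rep_eq id_apply metric_op_inverse)+

text \<open>\<open>dG\<close> as an operator-valued map of \<open>D\<close>, a form in which it can
  be differentiated again.\<close>

definition metric_op_deriv :: "'n::finite sym \<Rightarrow> 'n sym \<Rightarrow>\<^sub>L 'n sym \<Rightarrow>\<^sub>L 'n sym" where
  "metric_op_deriv D = Blinfun (frechet_derivative metric_op (at D))"

lemma has_derivative_metric_op_apply: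
  assumes D: "D \<in> posdef"
  shows "((\<lambda>E. blinfun_apply (metric_op E) X) has_derivative (\<lambda>H. integral {0..1} (metric_integrand1 D H X))) (at D)"
  by (rule has_derivative_transform_within_open[OF has_derivative_integral_metric_integrand[OF D] open_posdef D])
    (simp add: metric_op_eq_integral)

lemma has_derivative_metric_op:
  assumes D: "D \<in> posdef"
  shows "(metric_op has_derivative metric_op_deriv D) (at D)"
proof -
  have "metric_op differentiable (at D)"
    by (rule differentiable_blinfun_componentwise)
      (use has_derivative_metric_op_apply[OF D] in \<open>auto simp: differentiable_def\<close>)
  then have "(metric_op has_derivative frechet_derivative metric_op (at D)) (at D)"
    by (simp add: frechet_derivative_works)
  then show ?thesis
    by (simp add: metric_op_deriv_def bounded_linear_Blinfun_apply has_derivative_bounded_linear)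
qed

lemma metric_op_deriv_eq_integral:
  assumes D: "D \<in> posdef"
  shows "blinfun_apply (blinfun_apply (metric_op_deriv D) H) X = integral {0..1} (metric_integrand1 D H X)"
  using has_derivative_unique[OF has_derivative_blinfun_right[OF has_derivative_metric_op[OF D]]
      has_derivative_metric_op_apply[OF D]]
  by (rule fun_cong)

lemma metric_op_deriv_commute:
  "D \<in> posdef \<Longrightarrow> blinfun_apply (blinfun_apply (metric_op_deriv D) X) Y = blinfun_apply (blinfun_apply (metric_op_deriv D) Y) X"
  unfolding metric_op_deriv_eq_integral by (simp add: metric_integrand1_commute[of D X Y, abs_def])

text \<open>Self-adjointness of \<open>metric_op E\<close> holds for all \<open>E\<close> in an open
  set, so it can be differentiated.\<close>

lemma metric_op_deriv_self_adjoint: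
  assumes D: "D \<in> posdef"
  shows "blinfun_apply (blinfun_apply (metric_op_deriv D) H) X \<bullet> Y = X \<bullet> blinfun_apply (blinfun_apply (metric_op_deriv D) H) Y"
proof -
  note G = has_derivative_blinfun_right[OF has_derivative_metric_op[OF D]]
  have "((\<lambda>E. blinfun_apply (metric_op E) X \<bullet> Y) has_derivative (\<lambda>H. blinfun_apply (blinfun_apply (metric_op_deriv D) H) X \<bullet> Y)) (at D)"
    by (intro has_derivative_inner_left G)
  then have "((\<lambda>E. X \<bullet> blinfun_apply (metric_op E) Y) has_derivative (\<lambda>H. blinfun_apply (blinfun_apply (metric_op_deriv D) H) X \<bullet> Y)) (at D)"
    by (rule has_derivative_transform_within_open[OF _ open_posdef D]) (rule metric_op_self_adjoint)
  moreover have "((\<lambda>E. X \<bullet> blinfun_apply (metric_op E) Y) has_derivative (\<lambda>H. X \<bullet> blinfun_apply (blinfun_apply (metric_op_deriv D) H) Y)) (at D)"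
    by (intro has_derivative_inner_right G)
  ultimately show ?thesis by (metis has_derivative_unique)
qed

lemma differentiable_metric_op_deriv:
  assumes D: "D \<in> posdef"
  shows "metric_op_deriv differentiable (at D)"
proof (intro differentiable_blinfun_componentwise)
  fix X Y :: "'a sym"
  obtain F' where "((\<lambda>E. integral {0..1} (metric_integrand1 E X Y)) has_derivative F') (at D)"
    using differentiable_integral_metric_integrand1[OF D] by (auto simp: differentiable_def)
  then have "((\<lambda>E. blinfun_apply (blinfun_apply (metric_op_deriv E) X) Y) has_derivative F') (at D)"
    by (rule has_derivative_transform_within_open[OF _ open_posdef D]) (simp add: metric_op_deriv_eq_integral)
  then show "(\<lambda>E. blinfun_apply (blinfun_apply (metric_op_deriv E) X) Y) differentiable (at D)"
    by (auto simp: differentiable_def)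
qed

lemma has_derivative_metric_op_inv:
  assumes "D \<in> posdef"
  shows "(metric_op_inv has_derivative
    (\<lambda>H. - ((metric_op_inv D o\<^sub>L blinfun_apply (metric_op_deriv D) H) o\<^sub>L metric_op_inv D))) (at D)"
  by (rule has_derivative_blinfun_inverse[where U = posdef])
    (use assms in \<open>auto simp: metric_op_inverse open_posdef intro: has_derivative_metric_op\<close>)

section \<open>The Christoffel form, the connection and its curvature\<close>

lemma christoffel_eq:
  assumes D: "D \<in> posdef"
  shows "christoffel D X Y = - (1/2) *\<^sub>R blinfun_apply (metric_op_inv D) (blinfun_apply (blinfun_apply (metric_op_deriv D) X) Y)"
proof -
  have d: "dir_deriv (\<lambda>E. metric E X Y) D Z = blinfun_apply (blinfun_apply (metric_op_deriv D) Z) X \<bullet> Y" for X Y Z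
  proof (rule dir_deriv_eq)
    have "((\<lambda>E. blinfun_apply (metric_op E) X \<bullet> Y) has_derivative
        (\<lambda>Z. blinfun_apply (blinfun_apply (metric_op_deriv D) Z) X \<bullet> Y)) (at D)"
      by (intro has_derivative_inner_left has_derivative_blinfun_right has_derivative_metric_op D)
    then show "((\<lambda>E. metric E X Y) has_derivative
        (\<lambda>Z. blinfun_apply (blinfun_apply (metric_op_deriv D) Z) X \<bullet> Y)) (at D)"
      by (rule has_derivative_transform_within_open[OF _ open_posdef D]) (simp add: metric_eq_inner)
  qed
  \<comment> \<open>By total symmetry all three terms of the defining equation are the same number,
    with coefficients 1/2, -1/2 and -1/2.\<close>
  let ?T = "\<lambda>X Y. blinfun_apply (blinfun_apply (metric_op_deriv D) X) Y"
  have cyc: "?T Z X \<bullet> Y = ?T X Y \<bullet> Z" "?T X Z \<bullet> Y = ?T X Y \<bullet> Z" "?T Y X \<bullet> Z = ?T X Y \<bullet> Z" for Z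
    using metric_op_deriv_commute[OF D] metric_op_deriv_self_adjoint[OF D] by (metis inner_commute)+
  have rhs: "1/2 * dir_deriv (\<lambda>E. metric E X Y) D Z - 1/2 * dir_deriv (\<lambda>E. metric E Z Y) D X
      - 1/2 * dir_deriv (\<lambda>E. metric E X Z) D Y = (- (1/2) *\<^sub>R ?T X Y) \<bullet> Z" for Z
    by (simp add: d cyc)
  \<comment> \<open>The equivalence yields existence and uniqueness at once, which is what
    \<open>THE\<close> requires.\<close>
  have "(\<forall>Z. metric D W Z = (- (1/2) *\<^sub>R ?T X Y) \<bullet> Z) \<longleftrightarrow> W = - (1/2) *\<^sub>R blinfun_apply (metric_op_inv D) (?T X Y)" for W
  proof -
    have "(\<forall>Z. metric D W Z = (- (1/2) *\<^sub>R ?T X Y) \<bullet> Z) \<longleftrightarrow> blinfun_apply (metric_op D) W = - (1/2) *\<^sub>R ?T X Y"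
      unfolding metric_eq_inner[OF D] by (rule vector_eq_rdot)
    also have "\<dots> \<longleftrightarrow> W = blinfun_apply (metric_op_inv D) (- (1/2) *\<^sub>R ?T X Y)"
      using metric_op_inv_metric_op[OF D] by metis
    finally show ?thesis by (simp only: blinfun.scaleR_right)
  qed
  then show ?thesis unfolding christoffel_def rhs by simp
qed

lemma covariant_eq:
  assumes D: "D \<in> posdef" and \<eta>: "(\<eta> has_derivative \<eta>1) (at D)"
  shows "covariant \<xi> \<eta> D = \<eta>1 (\<xi> D)
    + (1/2) *\<^sub>R blinfun_apply (metric_op_inv D) (blinfun_apply (blinfun_apply (metric_op_deriv D) (\<xi> D)) (\<eta> D))"
  by (simp add: covariant_def christoffel_eq[OF D] dir_deriv_eq[OF \<eta>])

text \<open>The terms are arranged for exchanging \<open>\<xi>\<close> and \<open>\<eta>\<close>.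
  Those with \<open>\<zeta>2\<close>, with \<open>G2\<close>, and the pair with
  \<open>\<zeta>1 D\<close> inside \<open>T\<close> are symmetric; those with \<open>\<eta>1\<close>
  are matched by the bracket. What survives is -1/2, from differentiating
  \<open>G\<inverse>\<close>, plus 1/4, from applying the Christoffel term twice.\<close>

lemma covariant_covariant_eq:
  assumes D: "D \<in> posdef"
    and \<eta>: "(\<eta> has_derivative \<eta>1) (at D)"
    and \<zeta>: "\<forall>E\<in>posdef. (\<zeta> has_derivative blinfun_apply (\<zeta>1 E)) (at E)" "(\<zeta>1 has_derivative \<zeta>2) (at D)"
    and G2: "(metric_op_deriv has_derivative G2) (at D)"
  defines "Gi \<equiv> blinfun_apply (metric_op_inv D)" and "T \<equiv> \<lambda>X Y. blinfun_apply (blinfun_apply (metric_op_deriv D) X) Y"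
  shows "covariant \<xi> (covariant \<eta> \<zeta>) D =
      blinfun_apply (\<zeta>2 (\<xi> D)) (\<eta> D) + blinfun_apply (\<zeta>1 D) (\<eta>1 (\<xi> D))
    + (1/2) *\<^sub>R (Gi (blinfun_apply (blinfun_apply (G2 (\<xi> D)) (\<eta> D)) (\<zeta> D)) + Gi (T (\<eta>1 (\<xi> D)) (\<zeta> D))
        + Gi (T (\<eta> D) (blinfun_apply (\<zeta>1 D) (\<xi> D))) + Gi (T (\<xi> D) (blinfun_apply (\<zeta>1 D) (\<eta> D))))
    - (1/2) *\<^sub>R Gi (T (\<xi> D) (Gi (T (\<eta> D) (\<zeta> D)))) + (1/4) *\<^sub>R Gi (T (\<xi> D) (Gi (T (\<eta> D) (\<zeta> D))))"
proof -
  let ?N = "\<lambda>E. blinfun_apply (\<zeta>1 E) (\<eta> E)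
      + (1/2) *\<^sub>R blinfun_apply (metric_op_inv E) (blinfun_apply (blinfun_apply (metric_op_deriv E) (\<eta> E)) (\<zeta> E))"
  note app = bounded_bilinear.FDERIV[OF bounded_bilinear_blinfun_apply]
  have "(?N has_derivative (\<lambda>H. (blinfun_apply (\<zeta>1 D) (\<eta>1 H) + blinfun_apply (\<zeta>2 H) (\<eta> D))
      + (1/2) *\<^sub>R (blinfun_apply (metric_op_inv D)
            (blinfun_apply (blinfun_apply (metric_op_deriv D) (\<eta> D)) (blinfun_apply (\<zeta>1 D) H)
              + blinfun_apply (blinfun_apply (metric_op_deriv D) (\<eta>1 H) + blinfun_apply (G2 H) (\<eta> D)) (\<zeta> D))
          + blinfun_apply (- ((metric_op_inv D o\<^sub>L blinfun_apply (metric_op_deriv D) H) o\<^sub>L metric_op_inv D))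
            (blinfun_apply (blinfun_apply (metric_op_deriv D) (\<eta> D)) (\<zeta> D))))) (at D)"
    by (intro has_derivative_add has_derivative_scaleR_right app \<eta> \<zeta>(1)[rule_format] \<zeta>(2) G2 D has_derivative_metric_op_inv)
  moreover have "?N E = covariant \<eta> \<zeta> E" if "E \<in> posdef" for E
    by (simp add: covariant_eq[OF that \<zeta>(1)[rule_format, OF that]])
  ultimately have N: "(covariant \<eta> \<zeta> has_derivative (\<lambda>H. (blinfun_apply (\<zeta>1 D) (\<eta>1 H) + blinfun_apply (\<zeta>2 H) (\<eta> D))
      + (1/2) *\<^sub>R (blinfun_apply (metric_op_inv D)
            (blinfun_apply (blinfun_apply (metric_op_deriv D) (\<eta> D)) (blinfun_apply (\<zeta>1 D) H)
              + blinfun_apply (blinfun_apply (metric_op_deriv D) (\<eta>1 H) + blinfun_apply (G2 H) (\<eta> D)) (\<zeta> D))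
          + blinfun_apply (- ((metric_op_inv D o\<^sub>L blinfun_apply (metric_op_deriv D) H) o\<^sub>L metric_op_inv D))
            (blinfun_apply (blinfun_apply (metric_op_deriv D) (\<eta> D)) (\<zeta> D))))) (at D)"
    by (rule has_derivative_transform_within_open[OF _ open_posdef D])
  show ?thesis
    unfolding covariant_eq[OF D N] covariant_eq[OF D \<zeta>(1)[rule_format, OF D]] Gi_def T_def
    by (simp add: blinfun.bilinear_simps scaleR_add_right scaleR_diff_right)
qed

text \<open>The right-hand side involves only the values of the fields at \<open>D\<close>, so
  quantifying over all smooth fields includes tensoriality.\<close>

theorem mainTheorem1:
  fixes D X Y Z :: "'n::finite sym"
  assumes "D \<in> posdef"
  shows "(\<forall>\<xi> \<eta> \<zeta>. smooth_on posdef \<xi> \<and> smooth_on posdef \<eta> \<and> smooth_on posdef \<zeta> \<and>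
            \<xi> D = X \<and> \<eta> D = Y \<and> \<zeta> D = Z \<longrightarrow>
          curvature \<xi> \<eta> \<zeta> D =
              (1/4) *\<^sub>R dir_deriv metric_op_inv D X (dir_deriv metric_op D Y Z)
            - (1/4) *\<^sub>R dir_deriv metric_op_inv D Y (dir_deriv metric_op D X Z)) \<and>
         (1/4) *\<^sub>R dir_deriv metric_op_inv D X (dir_deriv metric_op D Y Z)
            - (1/4) *\<^sub>R dir_deriv metric_op_inv D Y (dir_deriv metric_op D X Z) =
         - (1/4) *\<^sub>R metric_op_inv D (dir_deriv metric_op D X (metric_op_inv D (dir_deriv metric_op D Y Z)))
            + (1/4) *\<^sub>R metric_op_inv D (dir_deriv metric_op D Y (metric_op_inv D (dir_deriv metric_op D X Z)))"
proof -
  note D = assms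
  have dG: "dir_deriv metric_op D H = blinfun_apply (metric_op_deriv D) H" for H
    by (rule dir_deriv_eq[OF has_derivative_metric_op[OF D]])
  have dGi: "dir_deriv metric_op_inv D H = - ((metric_op_inv D o\<^sub>L blinfun_apply (metric_op_deriv D) H) o\<^sub>L metric_op_inv D)" for H
    by (rule dir_deriv_eq[OF has_derivative_metric_op_inv[OF D]])
  obtain G2 where G2: "(metric_op_deriv has_derivative G2) (at D)"
    using differentiable_metric_op_deriv[OF D] by (auto simp: differentiable_def)
  \<comment> \<open>Symmetry of second derivatives is applied to the scalar functions
    \<open>metric_op E V \<bullet> W\<close> of \<open>E\<close>, with \<open>V\<close> and
    \<open>W\<close> fixed.\<close>
  have G2_sym: "blinfun_apply (blinfun_apply (G2 H) K) V = blinfun_apply (blinfun_apply (G2 K) H) V" for H K V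
  proof (rule vector_eq_rdot[THEN iffD1], rule allI)
    fix W
    have f: "((\<lambda>E. blinfun_apply (metric_op E) V \<bullet> W) has_derivative
        (\<lambda>H. blinfun_apply (blinfun_apply (metric_op_deriv E) H) V \<bullet> W)) (at E)" if "E \<in> posdef" for E
      by (intro has_derivative_inner_left has_derivative_blinfun_right has_derivative_metric_op that)
    have f1: "((\<lambda>E. blinfun_apply (blinfun_apply (metric_op_deriv E) H) V \<bullet> W) has_derivative
        (\<lambda>K. blinfun_apply (blinfun_apply (G2 K) H) V \<bullet> W)) (at D)" for H
      by (intro has_derivative_inner_left has_derivative_blinfun_right G2)
    show "blinfun_apply (blinfun_apply (G2 H) K) V \<bullet> W = blinfun_apply (blinfun_apply (G2 K) H) V \<bullet> W"
      using second_derivative_symmetric_real[OF open_posdef D f f1[of K] f1[of H]] by simp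
  qed
  have "curvature \<xi> \<eta> \<zeta> D =
              (1/4) *\<^sub>R dir_deriv metric_op_inv D X (dir_deriv metric_op D Y Z)
            - (1/4) *\<^sub>R dir_deriv metric_op_inv D Y (dir_deriv metric_op D X Z)"
    if smooth: "smooth_on posdef \<xi>" "smooth_on posdef \<eta>" "smooth_on posdef \<zeta>"
      and at_D: "\<xi> D = X" "\<eta> D = Y" "\<zeta> D = Z" for \<xi> \<eta> \<zeta>
  proof -
    have "Ck_on 2 posdef \<xi>" "Ck_on 2 posdef \<eta>" "Ck_on 2 posdef \<zeta>"
      using smooth unfolding smooth_on_def by blast+
    then obtain \<xi>1 \<eta>1 \<zeta>1 :: "'n sym \<Rightarrow> 'n sym \<Rightarrow>\<^sub>L 'n sym"
      where \<xi>: "(\<xi> has_derivative blinfun_apply (\<xi>1 D)) (at D)"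
        and \<eta>: "(\<eta> has_derivative blinfun_apply (\<eta>1 D)) (at D)"
        and \<zeta>: "\<forall>E\<in>posdef. (\<zeta> has_derivative blinfun_apply (\<zeta>1 E)) (at E)"
        and "\<zeta>1 differentiable (at D)"
      using D open_posdef by (metis Ck_on_imp_differentiable_derivative)
    then obtain \<zeta>2 where \<zeta>2: "(\<zeta>1 has_derivative \<zeta>2) (at D)"
      by (auto simp: differentiable_def)
    have \<zeta>2_sym: "blinfun_apply (\<zeta>2 H) K = blinfun_apply (\<zeta>2 K) H" for H K
      by (rule second_derivative_symmetric[OF open_posdef D \<zeta>[rule_format] \<zeta>2])
    show ?thesis
      unfolding curvature_def covariant_covariant_eq[OF D \<eta> \<zeta> \<zeta>2 G2] covariant_covariant_eq[OF D \<xi> \<zeta> \<zeta>2 G2]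
        covariant_eq[OF D bspec[OF \<zeta> D]] lie_bracket_def dir_deriv_eq[OF \<xi>] dir_deriv_eq[OF \<eta>] at_D dG dGi
        \<zeta>2_sym[of Y X] G2_sym[of Y X]
      \<comment> \<open>Pairing with an arbitrary vector turns the claim into a linear identity
        between real numbers, where the cancellation is plain arithmetic.\<close>
      by (rule vector_eq_rdot[THEN iffD1], rule allI)
        (simp only: blinfun.bilinear_simps blinfun_apply_blinfun_compose inner_simps; simp add: field_simps)
  qed
  \<comment> \<open>The second equality is the formula \<open>dGi\<close> for the derivative of the
    inverse, evaluated at \<open>dG(Y)(Z)\<close> and at \<open>dG(X)(Z)\<close>.\<close>
  then show ?thesis
    by (auto simp: dG dGi blinfun.bilinear_simps)
qed

end
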